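(* Assume $f\in\mathbb L^\infty(\mathbb S^1)$ and Assumption (A). Then for every $n$ and every $m\in\mathcal M_n$, \[ \mathbb E\|\tilde f_m-f\|_2^2\ \le\ C_1\|f_m-f\|_2^2+C_2\frac{D_m}{n}+C_3\frac1n, \] where $f_m$ is the $\mathbb L^2$-orthogonal projection of $f$ onto $S_m$, $C_1,C_2$ depend only on $\sigma_0$, and $C_3$ depends only on $\sigma_0$ and $\|f\|_\infty$. In particular, if in addition $f\in W(\beta,R)$ for some $\beta>0$, $R>0$, and $m=m_n$ is chosen so that $D_{m_n}$ is (up to the parity constraint that $D_m$ is odd) equal to $\lfloor n^{1/(2\beta+1)}\rfloor$, then $\mathbb E\|\tilde f_{m_n}-f\|_2^2=O\big(n^{-2\beta/(2\beta+1)}\big)$ as $n\to\infty$.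
   Context: Circle convention: $\mathbb S^1\cong[0,2\pi)$, anticlockwise orientation; for $x,y\in\mathbb S^1$, $[x,y]$ is the usual interval if $x\le y$ and $[x,2\pi)\cup[0,y]$ if $x>y$. Model: $X$ has density $f$ on $\mathbb S^1$; $(L,U)$ is a random pair in $(\mathbb S^1)^2$ independent of $X$ with $L\ne U$ a.s.; $(X_i,L_i,U_i)_{i\le n}$ i.i.d. copies; $\Delta_i=\mathbf 1\{X_i\in[L_i,U_i]\}$, $X_i'=X_i$ if $\Delta_i=1$ and $-\pi$ otherwise; observations $(X_i',L_i,U_i)_{i\le n}$. $\sigma(x)=\mathbb P(x\in[L,U])$. Assumption (A): there is $\sigma_0>0$ with $\sigma\ge\sigma_0$ on $\mathbb S^1$. Trigonometric basis $\varphi_0=1/\sqrt{2\pi}$, $\varphi_{2j-1}=\pi^{-1/2}\cos(j\cdot)$, $\varphi_{2j}=\pi^{-1/2}\sin(j\cdot)$; $\mathcal M_n=\{1,\dots,\lfloor n/2\rfloor-1\}$; for $m\in\mathcal M_n$, $\Lambda_m=\{0,\dots,2m\}$, $S_m=\mathrm{span}\{\varphi_\lambda:\lambda\in\Lambda_m\}$, $D_m=2m+1$. $\hat G_m$: $(\hat G_m)_{\lambda\lambda'}=\frac1n\sum_i\int_{[L_i,U_i]}\varphi_\lambda\varphi_{\lambda'}$; $\hat U_m=(\frac1n\sum_i\Delta_i\varphi_\lambda(X_i))_{\lambda\in\Lambda_m}$ ($\hat G_m$ is a.s. invertible). Estimator: $\mathring f_m=\sum_{\lambda\in\Lambda_m}\hat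 a_\lambda\varphi_\lambda$ with $(\hat a_\lambda)=\hat G_m^{-1}\hat U_m$ (the minimizer over $S_m$ of the contrast $\zeta(t)=\frac1n\sum_i(\int t^2\mathbf 1_{[L_i,U_i]}-2\Delta_i t(X_i'))$), and $\tilde f_m=\mathring f_m\,\mathbf 1\{\|\mathring f_m\|_2^2\le n^2\}$. Sobolev class: $\alpha_j=j^\beta$ ($j$ even), $\alpha_j=(j+1)^\beta$ ($j$ odd); $W(\beta,R)=\{g\in\mathbb L^2(\mathbb S^1):\sum_j\alpha_j^2\langle g,\varphi_j\rangle_2^2<R^2/\pi^{2\beta}\}$. *)

theory Defs
  imports "HOL-Probability.Probability"
begin

text \<open>The circle S^1 is identified with [0, 2pi); arcs [x,y] follow the anticlockwise convention.\<close>

definition circ :: "real set" where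
  "circ = {0..<2*pi}"

definition arc :: "real \<Rightarrow> real \<Rightarrow> real set" where
  "arc x y = (if x \<le> y then {x..y} else {x..<2*pi} \<union> {0..y})"

definition phi :: "nat \<Rightarrow> real \<Rightarrow> real" where
  "phi j x = (if j = 0 then 1 / sqrt (2*pi)
              else if odd j then cos (real ((j+1) div 2) * x) / sqrt pi
              else sin (real (j div 2) * x) / sqrt pi)"

definition coeff :: "(real \<Rightarrow> real) \<Rightarrow> nat \<Rightarrow> real" where
  "coeff g j = (LINT x:circ|lborel. g x * phi j x)"

definition l2sq :: "(real \<Rightarrow> real) \<Rightarrow> ennreal" where
  "l2sq g = (\<integral>\<^sup>+ x. ennreal ((g x)\<^sup>2) * indicator circ x \<partial>lborel)"

definition linf :: "(real \<Rightarrow> real) \<Rightarrow> real" where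
  "linf g = Inf {M. AE x in lborel. x \<in> circ \<longrightarrow> \<bar>g x\<bar> \<le> M}"

definition in_Linf :: "(real \<Rightarrow> real) \<Rightarrow> bool" where
  "in_Linf g \<longleftrightarrow> (\<exists>M. AE x in lborel. x \<in> circ \<longrightarrow> \<bar>g x\<bar> \<le> M)"

definition is_density :: "(real \<Rightarrow> real) \<Rightarrow> bool" where
  "is_density f \<longleftrightarrow> f \<in> borel_measurable lborel \<and> (\<forall>x\<in>circ. 0 \<le> f x)
     \<and> (\<integral>\<^sup>+ x. ennreal (f x) * indicator circ x \<partial>lborel) = 1"

definition Xlaw :: "(real \<Rightarrow> real) \<Rightarrow> real measure" where
  "Xlaw f = density lborel (\<lambda>x. ennreal (f x) * indicator circ x)"

definition censor_law :: "(real \<times> real) measure \<Rightarrow> bool" where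
  "censor_law \<mu> \<longleftrightarrow> prob_space \<mu> \<and> sets \<mu> = sets (borel :: (real \<times> real) measure)
     \<and> (AE p in \<mu>. fst p \<in> circ \<and> snd p \<in> circ \<and> fst p \<noteq> snd p)"

definition sigma_fun :: "(real \<times> real) measure \<Rightarrow> real \<Rightarrow> real" where
  "sigma_fun \<mu> x = measure \<mu> {p. x \<in> arc (fst p) (snd p)}"

definition assmA :: "(real \<times> real) measure \<Rightarrow> real \<Rightarrow> bool" where
  "assmA \<mu> \<sigma>0 \<longleftrightarrow> \<sigma>0 > 0 \<and> (\<forall>x\<in>circ. \<sigma>0 \<le> sigma_fun \<mu> x)"

definition sampleM :: "(real \<Rightarrow> real) \<Rightarrow> (real \<times> real) measure \<Rightarrow> nat
     \<Rightarrow> (nat \<Rightarrow> real \<times> real \<times> real) measure" where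
  "sampleM f \<mu> n = PiM {..<n} (\<lambda>_. Xlaw f \<Otimes>\<^sub>M \<mu>)"

definition Xs :: "(nat \<Rightarrow> real \<times> real \<times> real) \<Rightarrow> nat \<Rightarrow> real" where
  "Xs \<omega> i = fst (\<omega> i)"
definition Ls :: "(nat \<Rightarrow> real \<times> real \<times> real) \<Rightarrow> nat \<Rightarrow> real" where
  "Ls \<omega> i = fst (snd (\<omega> i))"
definition Us :: "(nat \<Rightarrow> real \<times> real \<times> real) \<Rightarrow> nat \<Rightarrow> real" where
  "Us \<omega> i = snd (snd (\<omega> i))"

definition Delta :: "(nat \<Rightarrow> real \<times> real \<times> real) \<Rightarrow> nat \<Rightarrow> real" where
  "Delta \<omega> i = indicator (arc (Ls \<omega> i) (Us \<omega> i)) (Xs \<omega> i)"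

definition Xobs :: "(nat \<Rightarrow> real \<times> real \<times> real) \<Rightarrow> nat \<Rightarrow> real" where
  "Xobs \<omega> i = (if Delta \<omega> i = 1 then Xs \<omega> i else - pi)"

definition Ghat :: "nat \<Rightarrow> (nat \<Rightarrow> real \<times> real \<times> real) \<Rightarrow> nat \<Rightarrow> nat \<Rightarrow> real" where
  "Ghat n \<omega> k l = (1 / real n) * (\<Sum>i<n. LINT x:arc (Ls \<omega> i) (Us \<omega> i)|lborel. phi k x * phi l x)"

definition Uhat :: "nat \<Rightarrow> (nat \<Rightarrow> real \<times> real \<times> real) \<Rightarrow> nat \<Rightarrow> real" where
  "Uhat n \<omega> k = (1 / real n) * (\<Sum>i<n. Delta \<omega> i * phi k (Xobs \<omega> i))"

text \<open>Coefficients (hat a_lambda) = Ghat_m^{-1} Uhat_m, indices Lambda_m = {0..2m}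
  (the unique solution of the linear system; Ghat_m is a.s. invertible).\<close>
definition ahat :: "nat \<Rightarrow> nat \<Rightarrow> (nat \<Rightarrow> real \<times> real \<times> real) \<Rightarrow> nat \<Rightarrow> real" where
  "ahat n m \<omega> = (THE a. (\<forall>k\<le>2*m. (\<Sum>l\<le>2*m. Ghat n \<omega> k l * a l) = Uhat n \<omega> k)
                          \<and> (\<forall>k>2*m. a k = 0))"

definition fring :: "nat \<Rightarrow> nat \<Rightarrow> (nat \<Rightarrow> real \<times> real \<times> real) \<Rightarrow> real \<Rightarrow> real" where
  "fring n m \<omega> x = (\<Sum>k\<le>2*m. ahat n m \<omega> k * phi k x)"

definition ftilde :: "nat \<Rightarrow> nat \<Rightarrow> (nat \<Rightarrow> real \<times> real \<times> real) \<Rightarrow> real \<Rightarrow> real" where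
  "ftilde n m \<omega> x = (if l2sq (fring n m \<omega>) \<le> ennreal ((real n)\<^sup>2) then fring n m \<omega> x else 0)"

definition proj :: "nat \<Rightarrow> (real \<Rightarrow> real) \<Rightarrow> real \<Rightarrow> real" where
  "proj m g x = (\<Sum>k\<le>2*m. coeff g k * phi k x)"

definition Dm :: "nat \<Rightarrow> nat" where
  "Dm m = 2*m + 1"

definition Mn :: "nat \<Rightarrow> nat set" where
  "Mn n = {1..n div 2 - 1}"

definition risk :: "(real \<Rightarrow> real) \<Rightarrow> (real \<times> real) measure \<Rightarrow> nat \<Rightarrow> nat \<Rightarrow> ennreal" where
  "risk f \<mu> n m = (\<integral>\<^sup>+ \<omega>. l2sq (\<lambda>x. ftilde n m \<omega> x - f x) \<partial>sampleM f \<mu> n)"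

definition alpha :: "real \<Rightarrow> nat \<Rightarrow> real" where
  "alpha \<beta> j = (if even j then real j powr \<beta> else real (j+1) powr \<beta>)"

definition Sobolev :: "real \<Rightarrow> real \<Rightarrow> (real \<Rightarrow> real) set" where
  "Sobolev \<beta> R = {g. set_integrable lborel circ (\<lambda>x. (g x)\<^sup>2)
      \<and> summable (\<lambda>j. (alpha \<beta> j)\<^sup>2 * (coeff g j)\<^sup>2)
      \<and> (\<Sum>j. (alpha \<beta> j)\<^sup>2 * (coeff g j)\<^sup>2) < R\<^sup>2 / pi powr (2*\<beta>)}"

end

theory Submission
  imports Defs
begin

text \<open>
  Write \<open>\<sigma>\<^sub>n\<close> for the empirical coverage, the proportion of observed arcs that contain a point. The
  quadratic form of \<open>Ghat\<close> is the integral of \<open>t\<^sup>2 \<sigma>\<^sub>n\<close>, so its least eigenvalue, in every dimension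
  at once, is at least the essential infimum of \<open>\<sigma>\<^sub>n\<close>. Cutting the circle at quantiles of the
  endpoint distributions gives a number of cells that depends only on \<open>\<sigma>0\<close>, and Hoeffding's inequality
  on each cell shows that this infimum is at least \<open>\<sigma>0 / 2\<close> up to an exponentially small probability.
  On that event the normal equations, tested against \<open>fring - proj\<close>, bound the estimation error
  by the bias plus the squared norm of a centred empirical mean, whose expectation is of order \<open>D / n\<close>;
  on the complement the truncation bounds the loss by a polynomial in \<open>n\<close>. For the rate, the bias is
  the tail of the Fourier series, because trigonometric polynomials are dense in \<open>L\<^sup>2\<close>
  (Stone-Weierstrass on the unit circle).
\<close>

section \<open>Square-integrable functions on the circle and the trigonometric basis\<close>

text \<open>The obstacle is the inversion of \<open>Ghat\<close>: concentration of this random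
  matrix entrywise or in operator norm could bring in factors that depend on \<open>m\<close>,
  whereas the constants may depend on \<open>s\<close> only. A pointwise lower bound on the
  empirical coverage serves every \<open>m\<close>, but the law of the endpoints is arbitrary and
  may have atoms, so the true coverage may jump; hence the cells are open and their finitely many
  boundary points are discarded. The constants come from one budget. The left and the right endpoint
  each fall inside a given cell with probability at most \<open>s / 8\<close>, which leaves
  \<open>3 / 4 * s\<close> for covering the whole cell, hence a margin \<open>s / 4\<close> above
  the threshold \<open>s / 2\<close> and the Hoeffding exponent 2 (s/4)^2 = s^2/8. The noise in the
  normal equations is centred given the arcs. The weight that accompanies \<open>f\<close> is then
  the empirical coverage, the same as in \<open>Ghat\<close>, so the approximation error enters only
  through \<open>f - proj m f\<close> and no comparison of the empirical with the true coverage is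
  left over.\<close>

definition circM :: "real measure" where
  "circM = restrict_space lborel circ"

lemma circ_sets [measurable]: "circ \<in> sets borel"
  by (simp add: circ_def)

lemma space_circM [simp]: "space circM = circ"
  by (simp add: circM_def space_restrict_space)

lemma emeasure_circM: "emeasure circM circ = ennreal (2 * pi)"
  by (simp add: circM_def emeasure_restrict_space circ_def)

lemma finite_measure_circM: "finite_measure circM"
  by (rule finite_measureI) (simp add: emeasure_circM)

interpretation circM: finite_measure circM
  by (rule finite_measure_circM)

lemma borel_measurable_circM: "g \<in> borel_measurable borel \<Longrightarrow> g \<in> borel_measurable circM"
  unfolding circM_def by (rule measurable_restrict_space1) simp

lemma set_integral_circ: "(LINT x:circ|lborel. g x) = integral\<^sup>L circM (g :: real \<Rightarrow> real)"
  unfolding circM_def by (subst integral_restrict_space) (auto simp: set_lebesgue_integral_def)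

lemma l2sq_circM: "l2sq g = (\<integral>\<^sup>+ x. ennreal ((g x)\<^sup>2) \<partial>circM)"
  unfolding circM_def l2sq_def by (subst nn_integral_restrict_space) auto

lemma AE_circM_iff: "(AE x in circM. P x) \<longleftrightarrow> (AE x in lborel. x \<in> circ \<longrightarrow> P x)"
  unfolding circM_def by (rule AE_restrict_space_iff) simp

text \<open>The half-open circle and the closed interval differ by the null point 2 pi, so the
  fundamental theorem on \<open>{0..2*pi}\<close> carries over.\<close>

lemma integral_circM_FTC:
  assumes "\<And>x. (F has_real_derivative g x) (at x)" and "continuous_on UNIV g"
  shows "integral\<^sup>L circM g = F (2 * pi) - F 0"
proof -
  have "(LINT x|lborel. g x * indicator {0..2*pi} x) = F (2 * pi) - F 0"
  proof (rule integral_FTC_Icc_real)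
    fix x
    show "isCont g x"
      using assms(2) continuous_on_eq_continuous_at by blast
  qed (use assms in auto)
  moreover have "(LINT x|lborel. indicator circ x *\<^sub>R g x) = (LINT x|lborel. g x * indicator {0..2*pi} x)"
  proof (rule integral_cong_AE)
    show "AE x in lborel. indicator circ x *\<^sub>R g x = g x * indicator {0..2*pi} x"
      using AE_lborel_singleton[of "2*pi"]
      by eventually_elim (auto simp: circ_def indicator_def)
    show "(\<lambda>x. indicator circ x *\<^sub>R g x) \<in> borel_measurable lborel"
      "(\<lambda>x. g x * indicator {0..2*pi} x) \<in> borel_measurable lborel"
      using borel_measurable_continuous_onI[OF assms(2)] by auto
  qed
  ultimately show ?thesis
    by (simp add: set_integral_circ[symmetric] set_lebesgue_integral_def)
qed

section \<open>Orthonormality of the trigonometric basis\<close>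

lemma integral_cos_circM: "integral\<^sup>L circM (\<lambda>x. cos (of_int p * x)) = (if p = 0 then 2 * pi else 0)"
proof (cases "p = 0")
  case True
  then show ?thesis
    by (simp add: measure_def emeasure_circM)
next
  case False
  have "integral\<^sup>L circM (\<lambda>x. cos (of_int p * x)) = sin (of_int p * (2 * pi)) / of_int p - sin (of_int p * 0) / of_int p"
    by (rule integral_circM_FTC)
       (use False in \<open>auto intro!: derivative_eq_intros continuous_intros\<close>)
  also have "\<dots> = 0"
    using sin_int_2pin[of p] by (simp add: mult_ac)
  finally show ?thesis
    using False by simp
qed

lemma integral_sin_circM: "integral\<^sup>L circM (\<lambda>x. sin (of_int p * x)) = 0"
proof (cases "p = 0")
  case False
  have "integral\<^sup>L circM (\<lambda>x. sin (of_int p * x)) = - cos (of_int p * (2 * pi)) / of_int p - - cos (of_int p * 0) / of_int p"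
    by (rule integral_circM_FTC)
       (use False in \<open>auto intro!: derivative_eq_intros continuous_intros\<close>)
  also have "\<dots> = 0"
    using cos_int_2pin[of p] by (simp add: mult_ac)
  finally show ?thesis .
qed simp

lemma integrable_circM_cos: "integrable circM (\<lambda>x. cos (c * x))"
  by (rule circM.integrable_const_bound[of _ 1]) (auto intro!: borel_measurable_circM)

lemma integrable_circM_sin: "integrable circM (\<lambda>x. sin (c * x))"
  by (rule circM.integrable_const_bound[of _ 1]) (auto intro!: borel_measurable_circM)

text \<open>Product-to-sum formulas leave the integer frequencies p - q and p + q, of which only
  frequency zero integrates to something. For p = q = 0 both conditions fire, giving 2 pi for the
  cosines and 0 for the sines.\<close>

lemma integral_trig_products:
  fixes p q :: int
  shows "integral\<^sup>L circM (\<lambda>x. cos (of_int p * x) * cos (of_int q * x)) =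
           (if p = q then pi else 0) + (if p = - q then pi else 0)"
    and "integral\<^sup>L circM (\<lambda>x. sin (of_int p * x) * sin (of_int q * x)) =
           (if p = q then pi else 0) - (if p = - q then pi else 0)"
    and "integral\<^sup>L circM (\<lambda>x. sin (of_int p * x) * cos (of_int q * x)) = 0"
proof -
  have d: "of_int p * x - of_int q * x = of_int (p - q) * x" "of_int p * x + of_int q * x = of_int (p + q) * x" for x :: real
    by (simp_all add: algebra_simps)
  show "integral\<^sup>L circM (\<lambda>x. cos (of_int p * x) * cos (of_int q * x)) =
           (if p = q then pi else 0) + (if p = - q then pi else 0)"
    unfolding cos_times_cos d
    by (subst integral_divide_zero, subst Bochner_Integration.integral_add[OF integrable_circM_cos integrable_circM_cos])
       (auto simp only: integral_cos_circM, auto)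
  show "integral\<^sup>L circM (\<lambda>x. sin (of_int p * x) * sin (of_int q * x)) =
           (if p = q then pi else 0) - (if p = - q then pi else 0)"
    unfolding sin_times_sin d
    by (subst integral_divide_zero, subst Bochner_Integration.integral_diff[OF integrable_circM_cos integrable_circM_cos])
       (auto simp only: integral_cos_circM, auto)
  show "integral\<^sup>L circM (\<lambda>x. sin (of_int p * x) * cos (of_int q * x)) = 0"
    unfolding sin_times_cos d
    by (subst integral_divide_zero, subst Bochner_Integration.integral_add[OF integrable_circM_sin integrable_circM_sin])
       (simp add: integral_sin_circM del: of_int_diff of_int_add)
qed

text \<open>Writing the constant as a cosine of frequency zero, and every frequency as an integer,
  lets each product of two basis functions match one of the product formulas without a special case
  for index 0.\<close>

lemma phi_cases:
  obtains "j = 0" "phi j = (\<lambda>x. cos (of_int 0 * x) / sqrt (2 * pi))"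
  | p :: nat where "0 < p" "j = 2 * p - 1" "phi j = (\<lambda>x. cos (of_int (int p) * x) / sqrt pi)"
  | p :: nat where "0 < p" "j = 2 * p" "phi j = (\<lambda>x. sin (of_int (int p) * x) / sqrt pi)"
proof (cases "j = 0")
  case True
  then show thesis by (intro that(1)) (auto simp: phi_def)
next
  case False
  show thesis
  proof (cases "odd j")
    case True
    then obtain p where "j = 2 * p + 1" by (elim oddE)
    then show thesis by (intro that(2)[of "p + 1"]) (auto simp: phi_def)
  next
    case False
    then obtain p where "j = 2 * p" by auto
    then show thesis using \<open>j \<noteq> 0\<close> by (intro that(3)[of p]) (auto simp: phi_def)
  qed
qed

lemma phi_orthonormal: "integral\<^sup>L circM (\<lambda>x. phi j x * phi k x) = (if j = k then 1 else 0)"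
proof -
  have s: "integral\<^sup>L circM (\<lambda>x. cos (of_int p * x) * sin (of_int q * x)) = 0" for p q
    using integral_trig_products(3)[of q p] by (simp add: mult.commute)
  have parity: "2 * p - Suc 0 \<noteq> 2 * q" "2 * q \<noteq> 2 * p - Suc 0" if "0 < p" for p q
    using that by presburger+
  show ?thesis
    by (cases j rule: phi_cases; cases k rule: phi_cases)
       (simp_all only: times_divide_times_eq integral_divide_zero integral_trig_products s,
        auto simp: parity real_sqrt_mult_self)
qed

lemma phi_bound: "(phi j x)\<^sup>2 \<le> 1 / pi"
proof -
  have *: "(cos y)\<^sup>2 \<le> 1" "(sin y)\<^sup>2 \<le> 1" for y :: real
    using sin_cos_squared_add[of y] by (smt (verit) zero_le_power2)+
  show ?thesis
    by (cases j rule: phi_cases) (auto simp: power_divide field_simps *)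
qed

lemma phi_abs_le_1: "\<bar>phi j x\<bar> \<le> 1"
proof -
  have "(phi j x)\<^sup>2 \<le> 1\<^sup>2"
    using phi_bound[of j x] pi_gt3 by (smt (verit) divide_le_eq_1 one_power2)
  then show ?thesis
    by (metis abs_le_square_iff abs_one)
qed

lemma phi_borel [measurable]: "phi j \<in> borel_measurable borel"
  unfolding phi_def[abs_def] by measurable

lemma phi_circM [measurable]: "phi j \<in> borel_measurable circM"
  by (rule borel_measurable_circM) simp

section \<open>Square integrability and orthogonal projection onto trigonometric polynomials\<close>

definition L2 :: "(real \<Rightarrow> real) \<Rightarrow> bool" where
  "L2 g \<longleftrightarrow> g \<in> borel_measurable circM \<and> integrable circM (\<lambda>x. (g x)\<^sup>2)"

lemma L2_measurable [measurable_dest]: "L2 g \<Longrightarrow> g \<in> borel_measurable circM"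
  by (simp add: L2_def)

lemma L2_mult_integrable:
  assumes "L2 g" "L2 h" shows "integrable circM (\<lambda>x. g x * h x)"
proof (rule Bochner_Integration.integrable_bound)
  show "integrable circM (\<lambda>x. (g x)\<^sup>2 + (h x)\<^sup>2)"
    using assms by (auto simp: L2_def)
  show "AE x in circM. norm (g x * h x) \<le> norm ((g x)\<^sup>2 + (h x)\<^sup>2)"
  proof (rule AE_I2)
    fix x
    have "2 * \<bar>g x * h x\<bar> \<le> (g x)\<^sup>2 + (h x)\<^sup>2"
      using sum_squares_bound[of "\<bar>g x\<bar>" "\<bar>h x\<bar>"] by (simp add: abs_mult)
    then show "norm (g x * h x) \<le> norm ((g x)\<^sup>2 + (h x)\<^sup>2)"
      by simp
  qed
qed (use assms in measurable)

lemma L2_add: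
  assumes "L2 g" "L2 h" shows "L2 (\<lambda>x. g x + h x)"
  using L2_mult_integrable[OF assms] assms by (auto simp: L2_def power2_sum mult.assoc)

lemma integral_square_add:
  assumes "L2 g" "L2 h"
  shows "integral\<^sup>L circM (\<lambda>x. (g x + h x)\<^sup>2) =
    integral\<^sup>L circM (\<lambda>x. (g x)\<^sup>2) + integral\<^sup>L circM (\<lambda>x. (h x)\<^sup>2) + 2 * integral\<^sup>L circM (\<lambda>x. g x * h x)"
  using L2_mult_integrable[OF assms] assms by (simp add: L2_def power2_sum mult.assoc)

lemma L2_cmult: "L2 g \<Longrightarrow> L2 (\<lambda>x. c * g x)"
  by (auto simp: L2_def power_mult_distrib)

lemma L2_diff: "L2 g \<Longrightarrow> L2 h \<Longrightarrow> L2 (\<lambda>x. g x - h x)"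
  using L2_add[of g "\<lambda>x. -1 * h x"] L2_cmult[of h "-1"] by simp

lemma L2_sum: "(\<And>i. i \<in> I \<Longrightarrow> L2 (g i)) \<Longrightarrow> L2 (\<lambda>x. \<Sum>i\<in>I. g i x)"
  by (induction I rule: infinite_finite_induct) (auto intro: L2_add, auto simp: L2_def)

lemma L2_bounded:
  assumes "g \<in> borel_measurable circM" "AE x in circM. \<bar>g x\<bar> \<le> B"
  shows "L2 g"
  unfolding L2_def
proof
  show "integrable circM (\<lambda>x. (g x)\<^sup>2)"
  proof (rule circM.integrable_const_bound[of _ "B\<^sup>2"])
    show "AE x in circM. norm ((g x)\<^sup>2) \<le> B\<^sup>2"
      using assms(2) by eventually_elim (auto simp: abs_le_square_iff[symmetric])
  qed (use assms in measurable)
qed fact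

lemma L2_phi: "L2 (phi j)"
  by (rule L2_bounded[of _ 1]) (auto simp: phi_abs_le_1)

lemma l2sq_L2: "L2 g \<Longrightarrow> l2sq g = ennreal (integral\<^sup>L circM (\<lambda>x. (g x)\<^sup>2))"
  unfolding l2sq_circM by (rule nn_integral_eq_integral) (auto simp: L2_def)

definition trig :: "nat \<Rightarrow> (nat \<Rightarrow> real) \<Rightarrow> real \<Rightarrow> real" where
  "trig m a x = (\<Sum>k\<le>2*m. a k * phi k x)"

lemma L2_trig: "L2 (trig m a)"
  unfolding trig_def[abs_def] by (intro L2_sum L2_cmult L2_phi)

lemma proj_eq_trig: "proj m g = trig m (coeff g)"
  by (simp add: fun_eq_iff proj_def trig_def)

lemma coeff_circM: "coeff g j = integral\<^sup>L circM (\<lambda>x. g x * phi j x)"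
  by (simp add: coeff_def set_integral_circ)

lemma integral_mult_trig:
  assumes "L2 g"
  shows "integral\<^sup>L circM (\<lambda>x. g x * trig m a x) = (\<Sum>k\<le>2*m. a k * coeff g k)"
proof -
  have "integral\<^sup>L circM (\<lambda>x. g x * trig m a x) = integral\<^sup>L circM (\<lambda>x. \<Sum>k\<le>2*m. a k * (g x * phi k x))"
    by (simp add: trig_def sum_distrib_left mult_ac)
  also have "\<dots> = (\<Sum>k\<le>2*m. integral\<^sup>L circM (\<lambda>x. a k * (g x * phi k x)))"
    by (intro Bochner_Integration.integral_sum integrable_mult_right L2_mult_integrable L2_phi assms)
  finally show ?thesis
    by (simp add: coeff_circM)
qed

lemma coeff_trig: "coeff (trig m a) k = (if k \<le> 2 * m then a k else 0)"
proof -
  have "coeff (trig m a) k = integral\<^sup>L circM (\<lambda>x. phi k x * trig m a x)"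
    by (simp add: coeff_circM mult.commute)
  also have "\<dots> = (\<Sum>l\<le>2*m. a l * coeff (phi k) l)"
    by (rule integral_mult_trig[OF L2_phi])
  also have "\<dots> = (\<Sum>l\<le>2*m. if l = k then a l else 0)"
    by (intro sum.cong) (auto simp: coeff_circM phi_orthonormal)
  finally show ?thesis
    by simp
qed

lemma norm_trig: "integral\<^sup>L circM (\<lambda>x. (trig m a x)\<^sup>2) = (\<Sum>k\<le>2*m. (a k)\<^sup>2)"
  using integral_mult_trig[OF L2_trig, of m a m a] by (simp add: coeff_trig power2_eq_square)

lemma trig_diff: "trig m a x - trig m b x = trig m (\<lambda>k. a k - b k) x"
  by (simp add: trig_def sum_subtractf left_diff_distrib)

lemma coeff_diff: "L2 g \<Longrightarrow> L2 h \<Longrightarrow> coeff (\<lambda>x. g x - h x) k = coeff g k - coeff h k"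
  by (simp add: coeff_circM left_diff_distrib L2_mult_integrable L2_phi)

text \<open>The residual \<open>proj m g - g\<close> has vanishing coefficients up to index 2m,
  hence is orthogonal to every \<open>trig m\<close>. This one identity yields the optimality of the
  projection, the split of the loss into bias and estimation error, and the comparison of
  projections of different degrees.\<close>

lemma pythagoras_trig:
  assumes "L2 g"
  shows "integral\<^sup>L circM (\<lambda>x. (trig m a x - g x)\<^sup>2) =
         integral\<^sup>L circM (\<lambda>x. (proj m g x - g x)\<^sup>2) + (\<Sum>k\<le>2*m. (a k - coeff g k)\<^sup>2)"
proof -
  let ?r = "\<lambda>x. proj m g x - g x" and ?d = "trig m (\<lambda>k. a k - coeff g k)"
  have r: "L2 ?r"
    unfolding proj_eq_trig by (intro L2_diff L2_trig assms)
  have eq: "trig m a x - g x = ?r x + ?d x" for x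
    by (simp add: proj_eq_trig trig_diff[symmetric])
  have "integral\<^sup>L circM (\<lambda>x. ?r x * ?d x) = 0"
    unfolding integral_mult_trig[OF r] unfolding proj_eq_trig
    by (auto simp: coeff_diff L2_trig assms coeff_trig intro!: sum.neutral)
  then show ?thesis
    unfolding eq by (simp add: norm_trig integral_square_add[OF r L2_trig])
qed

section \<open>Completeness of the trigonometric system\<close>

lemma trig_extend: "m \<le> M \<Longrightarrow> trig m a = trig M (\<lambda>k. if k \<le> 2 * m then a k else 0)"
proof
  fix x assume "m \<le> M"
  have "trig M (\<lambda>k. if k \<le> 2 * m then a k else 0) x = (\<Sum>k\<le>2*M. if k \<in> {..2*m} then a k * phi k x else 0)"
    unfolding trig_def by (intro sum.cong) auto
  also have "\<dots> = (\<Sum>k\<in>{..2*M} \<inter> {..2*m}. a k * phi k x)"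
    by (rule sum.inter_restrict[symmetric]) simp
  also have "{..2*M} \<inter> {..2*m} = {..2*m}"
    using \<open>m \<le> M\<close> by auto
  finally show "trig m a x = trig M (\<lambda>k. if k \<le> 2 * m then a k else 0) x"
    by (simp add: trig_def)
qed

section \<open>The algebra of trigonometric polynomials\<close>

definition trig_polys :: "(real \<Rightarrow> real) set" where
  "trig_polys = {g. \<exists>m a. g = trig m a}"

lemma trig_polys_add:
  assumes "g \<in> trig_polys" "h \<in> trig_polys" shows "(\<lambda>x. g x + h x) \<in> trig_polys"
proof -
  obtain m a k b where g: "g = trig m a" and h: "h = trig k b"
    using assms by (auto simp: trig_polys_def)
  obtain a' b' where "g = trig (max m k) a'" "h = trig (max m k) b'"
    using trig_extend[of m "max m k" a] trig_extend[of k "max m k" b] g h by auto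
  then have "(\<lambda>x. g x + h x) = trig (max m k) (\<lambda>i. a' i + b' i)"
    by (simp add: trig_def fun_eq_iff sum.distrib distrib_right)
  then show ?thesis
    by (auto simp: trig_polys_def)
qed

lemma trig_polys_cmult:
  assumes "g \<in> trig_polys" shows "(\<lambda>x. c * g x) \<in> trig_polys"
proof -
  obtain m a where g: "g = trig m a"
    using assms by (auto simp: trig_polys_def)
  then have "(\<lambda>x. c * g x) = trig m (\<lambda>i. c * a i)"
    by (simp add: trig_def fun_eq_iff sum_distrib_left mult_ac)
  then show ?thesis
    by (auto simp: trig_polys_def)
qed

lemma trig_polys_phi: "phi k \<in> trig_polys"
proof -
  have "trig k (\<lambda>i. if i = k then 1 else 0) x = phi k x" for x
    unfolding trig_def by (subst sum.remove[of _ k]) auto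
  then show ?thesis
    by (auto simp: trig_polys_def fun_eq_iff intro!: exI[of _ k] exI[of _ "\<lambda>i. if i = k then 1 else 0"])
qed

lemma trig_polys_cos_nat: "(\<lambda>x. cos (real p * x)) \<in> trig_polys"
proof (cases "p = 0")
  case True
  then have "(\<lambda>x. cos (real p * x)) = (\<lambda>x. sqrt (2 * pi) * phi 0 x)"
    by (simp add: phi_def)
  then show ?thesis
    by (simp only: trig_polys_cmult trig_polys_phi)
next
  case False
  then have "(\<lambda>x. cos (real p * x)) = (\<lambda>x. sqrt pi * phi (2 * p - 1) x)"
    by (auto simp: phi_def)
  then show ?thesis
    by (simp only: trig_polys_cmult trig_polys_phi)
qed

lemma trig_polys_sin_nat: "(\<lambda>x. sin (real p * x)) \<in> trig_polys"
proof -
  have "(\<lambda>x. sin (real p * x)) = (\<lambda>x. (if p = 0 then 0 else sqrt pi) * phi (2 * p) x)"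
    by (auto simp: phi_def)
  then show ?thesis
    by (simp only: trig_polys_cmult trig_polys_phi)
qed

lemma trig_polys_cos: "(\<lambda>x. cos (of_int p * x)) \<in> trig_polys"
proof (cases p)
  case (nonneg n)
  then show ?thesis using trig_polys_cos_nat[of n] by simp
next
  case (neg n)
  have "cos (of_int p * x) = cos (real (Suc n) * x)" for x
    unfolding neg of_int_minus of_int_of_nat_eq mult_minus_left cos_minus ..
  then show ?thesis using trig_polys_cos_nat[of "Suc n"] by presburger
qed

lemma trig_polys_sin: "(\<lambda>x. sin (of_int p * x)) \<in> trig_polys"
proof (cases p)
  case (nonneg n)
  then show ?thesis using trig_polys_sin_nat[of n] by simp
next
  case (neg n)
  have "sin (of_int p * x) = - 1 * sin (real (Suc n) * x)" for x
    unfolding neg of_int_minus of_int_of_nat_eq mult_minus_left sin_minus by simp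
  then show ?thesis using trig_polys_cmult[OF trig_polys_sin_nat[of "Suc n"], of "-1"] by presburger
qed

lemma trig_polys_products:
  fixes p q :: int
  shows "(\<lambda>x. cos (of_int p * x) * cos (of_int q * x)) \<in> trig_polys"
    and "(\<lambda>x. sin (of_int p * x) * sin (of_int q * x)) \<in> trig_polys"
    and "(\<lambda>x. sin (of_int p * x) * cos (of_int q * x)) \<in> trig_polys"
proof -
  have d: "of_int p * x - of_int q * x = of_int (p - q) * x" "of_int p * x + of_int q * x = of_int (p + q) * x" for x :: real
    by (simp_all add: algebra_simps)
  have half: "(a + b) / 2 = 1/2 * a + 1/2 * b" "(a - b) / 2 = 1/2 * a + (- 1/2) * b" for a b :: real
    by (simp_all add: field_simps)
  show "(\<lambda>x. cos (of_int p * x) * cos (of_int q * x)) \<in> trig_polys"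
    "(\<lambda>x. sin (of_int p * x) * sin (of_int q * x)) \<in> trig_polys"
    "(\<lambda>x. sin (of_int p * x) * cos (of_int q * x)) \<in> trig_polys"
    unfolding cos_times_cos sin_times_sin sin_times_cos d half
    by (intro trig_polys_add trig_polys_cmult trig_polys_cos trig_polys_sin)+
qed

lemma trig_polys_phi_mult: "(\<lambda>x. phi j x * phi k x) \<in> trig_polys"
proof -
  have s: "(\<lambda>x. cos (of_int p * x) * sin (of_int q * x)) \<in> trig_polys" for p q
    using trig_polys_products(3)[of q p] by (simp add: mult.commute)
  have div: "a / b = 1 / b * a" for a b :: real
    by simp
  show ?thesis
    by (cases j rule: phi_cases; cases k rule: phi_cases)
       (simp_all only: times_divide_times_eq div[of "_ * _"] trig_polys_cmult trig_polys_products s)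
qed

lemma trig_polys_sum:
  "finite I \<Longrightarrow> (\<And>i. i \<in> I \<Longrightarrow> g i \<in> trig_polys) \<Longrightarrow> (\<lambda>x. \<Sum>i\<in>I. g i x) \<in> trig_polys"
proof (induction I rule: finite_induct)
  case empty
  then show ?case using trig_polys_cmult[OF trig_polys_phi, of 0 0] by simp
next
  case (insert i I)
  then show ?case by (simp add: trig_polys_add)
qed

lemma trig_polys_mult:
  assumes "g \<in> trig_polys" "h \<in> trig_polys" shows "(\<lambda>x. g x * h x) \<in> trig_polys"
proof -
  obtain m a k b where g: "g = trig m a" and h: "h = trig k b"
    using assms by (auto simp: trig_polys_def)
  have "(\<lambda>x. g x * h x) = (\<lambda>x. \<Sum>i\<le>2*m. \<Sum>j\<le>2*k. (a i * b j) * (phi i x * phi j x))"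
    by (simp add: g h trig_def sum_product mult_ac)
  then show ?thesis
    by (auto intro!: trig_polys_sum trig_polys_cmult trig_polys_phi_mult)
qed

text \<open>A real-linear functional of \<open>cis x\<close> is a combination of cos x and sin x;
  constants, sums and products stay in \<open>trig_polys\<close> because it is an algebra. This
  translates Stone-Weierstrass on the circle into the basis \<open>phi\<close>.\<close>

lemma trig_polys_real_polynomial:
  fixes q :: "complex \<Rightarrow> real"
  assumes "real_polynomial_function q"
  shows "(\<lambda>x. q (cis x)) \<in> trig_polys"
  using assms
proof induction
  case (linear f)
  interpret bounded_linear f by fact
  have "f (cis x) = f 1 * cos (of_int 1 * x) + f \<i> * sin (of_int 1 * x)" for x
  proof -
    have "cis x = cos x *\<^sub>R 1 + sin x *\<^sub>R \<i>"
      by (simp add: complex_eq_iff)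
    then show ?thesis
      by (simp add: add scaleR)
  qed
  then show ?case
    by (simp only: trig_polys_add trig_polys_cmult trig_polys_cos trig_polys_sin)
next
  case (const c)
  have "(\<lambda>x. c * cos (of_int 0 * x)) \<in> trig_polys"
    by (intro trig_polys_cmult trig_polys_cos)
  then show ?case by simp
next
  case (add f g)
  then show ?case by (intro trig_polys_add)
next
  case (mult f g)
  then show ?case by (intro trig_polys_mult)
qed

section \<open>Density of trigonometric polynomials in the square mean\<close>

lemma loop_approx_trig_poly:
  fixes w :: "real \<Rightarrow> real"
  assumes "continuous_on {0..2*pi} w" "w 0 = w (2 * pi)" "0 < e"
  obtains g where "g \<in> trig_polys" "\<And>x. x \<in> circ \<Longrightarrow> \<bar>w x - g x\<bar> < e"
proof -
  define p where "p t = w (2 * pi * t)" for t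
  have "path p"
    unfolding path_def p_def
    by (intro continuous_on_compose2[OF assms(1)] continuous_intros) (auto simp: mult_left_le)
  \<comment> \<open>The constant homotopy of the loop \<open>p\<close> shows that \<open>p\<close> factors continuously through the circle.\<close>
  then have "homotopic_loops UNIV p p"
    using assms(2) by (simp add: homotopic_loops_refl pathstart_def pathfinish_def p_def)
  then have "homotopic_with_canon (\<lambda>h. True) (sphere 0 1) UNIV
      (p \<circ> (\<lambda>z. (Arg2pi z / (2 * pi)))) (p \<circ> (\<lambda>z. (Arg2pi z / (2 * pi))))"
    by (rule homotopic_loops_imp_homotopic_circlemaps)
  then have "continuous_on (sphere 0 1) (p \<circ> (\<lambda>z. (Arg2pi z / (2 * pi))))"
    using homotopic_with_imp_continuous by blast
  then obtain q where q: "real_polynomial_function q"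
      "\<And>z. z \<in> sphere 0 1 \<Longrightarrow> \<bar>(p \<circ> (\<lambda>z. (Arg2pi z / (2 * pi)))) z - q z\<bar> < e"
    using Stone_Weierstrass_real_polynomial_function[OF compact_sphere _ \<open>0 < e\<close>] by blast
  show thesis
  proof
    show "(\<lambda>x. q (cis x)) \<in> trig_polys"
      by (rule trig_polys_real_polynomial[OF q(1)])
    fix x assume x: "x \<in> circ"
    \<comment> \<open>\<open>Arg2pi\<close> takes values in [0, 2 pi), which is exactly
      \<open>circ\<close>, so it inverts \<open>cis\<close> there without correction.\<close>
    have "Arg2pi (cis x) = x"
      using x by (intro Arg2pi_unique[of 1]) (auto simp: circ_def cis_conv_exp)
    then show "\<bar>w x - q (cis x)\<bar> < e"
      using q(2)[of "cis x"] by (simp add: p_def)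
  qed
qed

text \<open>\<open>measurable_on\<close> supplies continuous functions that converge to
  \<open>g\<close> off a negligible set. They need not be bounded and need not close up at 0 and 2
  pi; both are repaired without disturbing the limit almost everywhere, and dominated convergence
  concludes.\<close>

lemma bounded_approx_loops:
  fixes g :: "real \<Rightarrow> real"
  assumes [measurable]: "g \<in> borel_measurable borel" and bd: "AE x in circM. \<bar>g x\<bar> \<le> B"
  obtains w where "\<And>n. continuous_on UNIV (w n)" "\<And>n. w n 0 = w n (2 * pi)"
    "(\<lambda>n. integral\<^sup>L circM (\<lambda>x. (g x - w n x)\<^sup>2)) \<longlonglongrightarrow> 0"
proof -
  have "g \<in> borel_measurable lebesgue"
    by (simp add: measurable_completion)
  then have "g measurable_on UNIV"
    by (rule lebesgue_measurable_imp_measurable_on) simp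
  then obtain N h where N: "negligible N" and h: "\<And>n. continuous_on UNIV (h n)"
      and lim: "\<And>x. x \<notin> N \<Longrightarrow> (\<lambda>n. h n x) \<longlonglongrightarrow> g x"
    by (auto simp: measurable_on_def)
  \<comment> \<open>Clipping at \<bar>B\<bar> gives the dominating constant and fixes the limit
    \<open>g x\<close>. The second factor vanishes at 0 and at 2 pi, so the ends agree, and equals 1
    from some \<open>n\<close> on at each interior point.\<close>
  define w where "w n x = max (- \<bar>B\<bar>) (min \<bar>B\<bar> (h n x)) * max 0 (min 1 (real n * (x * (2 * pi - x))))" for n x
  have cont: "continuous_on UNIV (w n)" for n
    unfolding w_def[abs_def] by (intro continuous_intros h)
  then have [measurable]: "w n \<in> borel_measurable borel" for n
    by (rule borel_measurable_continuous_onI)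
  have wB: "\<bar>w n x\<bar> \<le> \<bar>B\<bar>" for n x
  proof -
    have "\<bar>max (- \<bar>B\<bar>) (min \<bar>B\<bar> (h n x))\<bar> * \<bar>max 0 (min 1 (real n * (x * (2 * pi - x))))\<bar> \<le> \<bar>B\<bar> * 1"
      by (intro mult_mono) auto
    then show ?thesis
      by (simp add: w_def abs_mult)
  qed
  have "AE x in lebesgue. x \<notin> N"
    using N by (intro AE_not_in) (simp add: negligible_iff_null_sets)
  then have notN: "AE x in circM. x \<notin> N"
    unfolding AE_circM_iff AE_completion_iff by eventually_elim auto
  have not0: "AE x in circM. x \<noteq> 0"
    unfolding AE_circM_iff using AE_lborel_singleton[of 0] by eventually_elim auto
  have wlim: "AE x in circM. (\<lambda>n. w n x) \<longlonglongrightarrow> g x"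
    using notN bd not0 AE_space
  proof eventually_elim
    case (elim x)
    have pos: "0 < x * (2 * pi - x)"
      using elim by (auto simp: circ_def)
    have "filterlim (\<lambda>n. real n * (x * (2 * pi - x))) at_top sequentially"
      using pos by (intro filterlim_at_top_mult_tendsto_pos[OF tendsto_const] filterlim_real_sequentially)
    then have "\<forall>\<^sub>F n in sequentially. 1 \<le> real n * (x * (2 * pi - x))"
      by (simp add: filterlim_at_top)
    then have "\<forall>\<^sub>F n in sequentially. w n x = max (- \<bar>B\<bar>) (min \<bar>B\<bar> (h n x))"
      by eventually_elim (simp add: w_def)
    moreover have "(\<lambda>n. max (- \<bar>B\<bar>) (min \<bar>B\<bar> (h n x))) \<longlonglongrightarrow> max (- \<bar>B\<bar>) (min \<bar>B\<bar> (g x))"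
      using elim by (intro tendsto_intros lim)
    moreover have "max (- \<bar>B\<bar>) (min \<bar>B\<bar> (g x)) = g x"
      using elim by auto
    ultimately show ?case
      by (simp add: tendsto_cong)
  qed
  have "(\<lambda>n. integral\<^sup>L circM (\<lambda>x. (g x - w n x)\<^sup>2)) \<longlonglongrightarrow> integral\<^sup>L circM (\<lambda>x. 0)"
  proof (rule integral_dominated_convergence[where w = "\<lambda>_. (2 * \<bar>B\<bar>)\<^sup>2"])
    show "AE x in circM. (\<lambda>n. (g x - w n x)\<^sup>2) \<longlonglongrightarrow> 0"
      using wlim
    proof eventually_elim
      case (elim x)
      have "(\<lambda>n. (g x - w n x)\<^sup>2) \<longlonglongrightarrow> (g x - g x)\<^sup>2"
        using elim by (intro tendsto_intros)
      then show ?case by simp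
    qed
    show "AE x in circM. norm ((g x - w n x)\<^sup>2) \<le> (2 * \<bar>B\<bar>)\<^sup>2" for n
      using bd
    proof eventually_elim
      case (elim x)
      then have "\<bar>g x - w n x\<bar> \<le> \<bar>2 * \<bar>B\<bar>\<bar>"
        using wB[of n x] by auto
      then show ?case
        by (simp only: abs_le_square_iff real_norm_def abs_power2)
    qed
  qed (auto intro!: borel_measurable_circM)
  moreover have "w n 0 = w n (2 * pi)" for n
    by (simp add: w_def)
  ultimately show thesis
    using cont by (intro that) auto
qed

lemma bounded_approx_trig_poly:
  fixes g :: "real \<Rightarrow> real"
  assumes g [measurable]: "g \<in> borel_measurable borel" and bd: "AE x in circM. \<bar>g x\<bar> \<le> B" and "0 < e"
  obtains m a where "integral\<^sup>L circM (\<lambda>x. (trig m a x - g x)\<^sup>2) < e"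
proof -
  obtain w where w: "\<And>n. continuous_on UNIV (w n)" "\<And>n. w n 0 = w n (2 * pi)"
      and lim: "(\<lambda>n. integral\<^sup>L circM (\<lambda>x. (g x - w n x)\<^sup>2)) \<longlonglongrightarrow> 0"
    by (rule bounded_approx_loops[OF g bd]) (rule that)
  have "\<forall>\<^sub>F n in sequentially. integral\<^sup>L circM (\<lambda>x. (g x - w n x)\<^sup>2) < e / 4"
    using lim \<open>0 < e\<close> by (intro order_tendstoD(2)[OF lim]) auto
  then obtain n where n: "integral\<^sup>L circM (\<lambda>x. (g x - w n x)\<^sup>2) < e / 4"
    by (auto simp: eventually_sequentially)
  \<comment> \<open>With this \<open>d\<close> the uniform error contributes 2 d^2 * 2 pi = e/4 and
    the other term less than 2 * e/4, in total less than \<open>e\<close>.\<close>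
  define d where "d = sqrt (e / (16 * pi))"
  have d: "0 < d" "d\<^sup>2 = e / (16 * pi)"
    using \<open>0 < e\<close> by (auto simp: d_def)
  obtain q where q: "q \<in> trig_polys" "\<And>x. x \<in> circ \<Longrightarrow> \<bar>w n x - q x\<bar> < d"
    by (rule loop_approx_trig_poly[OF continuous_on_subset[OF w(1)[of n]] w(2)[of n] d(1)]) (auto intro: that)
  obtain m a where qt: "q = trig m a"
    using q(1) by (auto simp: trig_polys_def)
  have Lg: "L2 g"
    by (rule L2_bounded[OF borel_measurable_circM[OF g] bd])
  have "compact (w n ` {0..2*pi})"
    by (intro compact_continuous_image continuous_on_subset[OF w(1)]) auto
  then obtain C where "\<And>x. x \<in> {0..2*pi} \<Longrightarrow> \<bar>w n x\<bar> \<le> C"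
    by (metis bounded_iff compact_imp_bounded imageI real_norm_def)
  then have Lw: "L2 (w n)"
    by (intro L2_bounded[of _ C] borel_measurable_circM borel_measurable_continuous_onI w AE_I2) (auto simp: circ_def)
  have int: "integrable circM (\<lambda>x. (g x - w n x)\<^sup>2)"
    using L2_diff[OF Lg Lw] by (simp add: L2_def)
  have "integral\<^sup>L circM (\<lambda>x. (q x - g x)\<^sup>2) \<le> integral\<^sup>L circM (\<lambda>x. 2 * (g x - w n x)\<^sup>2 + 2 * d\<^sup>2)"
  proof (rule integral_mono)
    show "integrable circM (\<lambda>x. (q x - g x)\<^sup>2)"
      using L2_diff[OF L2_trig Lg, of m a] by (simp add: qt L2_def)
    show "integrable circM (\<lambda>x. 2 * (g x - w n x)\<^sup>2 + 2 * d\<^sup>2)"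
      using int by simp
    fix x assume "x \<in> space circM"
    then have "(w n x - q x)\<^sup>2 \<le> d\<^sup>2"
      using q(2)[of x] d(1) by (simp add: abs_le_square_iff[symmetric])
    moreover have "(q x - g x)\<^sup>2 \<le> 2 * (g x - w n x)\<^sup>2 + 2 * (w n x - q x)\<^sup>2"
      using zero_le_power2[of "(g x - w n x) - (w n x - q x)"]
      by (simp add: power2_eq_square algebra_simps)
    ultimately show "(q x - g x)\<^sup>2 \<le> 2 * (g x - w n x)\<^sup>2 + 2 * d\<^sup>2"
      by linarith
  qed
  also have "\<dots> = 2 * integral\<^sup>L circM (\<lambda>x. (g x - w n x)\<^sup>2) + 2 * d\<^sup>2 * (2 * pi)"
    using int by (simp add: measure_def emeasure_circM)
  also have "\<dots> < e"
    using n d \<open>0 < e\<close> by simp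
  finally show thesis
    using qt by (intro that) auto
qed

text \<open>This is the inequality half of Parseval for the residual. By density some degree
  \<open>M\<close> has projection error at most \<open>e\<close>, and passing from degree
  \<open>m\<close> to \<open>M\<close> changes the squared error by exactly a finite sum of squared
  coefficients. Asking for \<open>T\<close> to bound all finite sums keeps infinite series out of
  the argument.\<close>

lemma proj_tail_bound:
  fixes g :: "real \<Rightarrow> real"
  assumes g: "g \<in> borel_measurable borel" and bd: "AE x in circM. \<bar>g x\<bar> \<le> B"
    and tail: "\<And>M. m \<le> M \<Longrightarrow> (\<Sum>k\<in>{2*m<..2*M}. (coeff g k)\<^sup>2) \<le> T"
  shows "integral\<^sup>L circM (\<lambda>x. (proj m g x - g x)\<^sup>2) \<le> T"
proof (rule field_le_epsilon)
  fix e :: real assume "0 < e"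
  then obtain m' a where a: "integral\<^sup>L circM (\<lambda>x. (trig m' a x - g x)\<^sup>2) < e"
    using bounded_approx_trig_poly[OF g bd] by blast
  define M where "M = max m m'"
  have Lg: "L2 g"
    by (rule L2_bounded[OF borel_measurable_circM[OF g] bd])
  obtain b where b: "trig m' a = trig M b"
    using trig_extend[of m' M a] by (auto simp: M_def)
  have "integral\<^sup>L circM (\<lambda>x. (proj M g x - g x)\<^sup>2) \<le> integral\<^sup>L circM (\<lambda>x. (trig M b x - g x)\<^sup>2)"
    unfolding pythagoras_trig[OF Lg, of M b] by (simp add: sum_nonneg)
  then have M: "integral\<^sup>L circM (\<lambda>x. (proj M g x - g x)\<^sup>2) \<le> e"
    using a b by simp
  have "integral\<^sup>L circM (\<lambda>x. (proj m g x - g x)\<^sup>2)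
      = integral\<^sup>L circM (\<lambda>x. (trig M (\<lambda>k. if k \<le> 2 * m then coeff g k else 0) x - g x)\<^sup>2)"
    by (simp add: proj_eq_trig trig_extend[of m M] M_def)
  also have "\<dots> = integral\<^sup>L circM (\<lambda>x. (proj M g x - g x)\<^sup>2)
      + (\<Sum>k\<le>2*M. ((if k \<le> 2 * m then coeff g k else 0) - coeff g k)\<^sup>2)"
    by (rule pythagoras_trig[OF Lg])
  also have "(\<Sum>k\<le>2*M. ((if k \<le> 2 * m then coeff g k else 0) - coeff g k)\<^sup>2) = (\<Sum>k\<in>{2*m<..2*M}. (coeff g k)\<^sup>2)"
    by (intro sum.mono_neutral_cong_right) auto
  finally show "integral\<^sup>L circM (\<lambda>x. (proj m g x - g x)\<^sup>2) \<le> T + e"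
    using M tail[of M] by (simp add: M_def)
qed

section \<open>Arcs and quantile cells\<close>

lemma mem_arc: "x \<in> arc l u \<longleftrightarrow> (if l \<le> u then l \<le> x \<and> x \<le> u else (l \<le> x \<and> x < 2 * pi) \<or> (0 \<le> x \<and> x \<le> u))"
  by (auto simp: arc_def)

lemma arc_subset_circ: "l \<in> circ \<Longrightarrow> u \<in> circ \<Longrightarrow> arc l u \<subseteq> circ"
  by (auto simp: arc_def circ_def)

lemma arc_pred_measurable [measurable (raw)]:
  assumes [measurable]: "f \<in> borel_measurable M" "g \<in> borel_measurable M" "h \<in> borel_measurable M"
  shows "Measurable.pred M (\<lambda>z. f z \<in> arc (g z) (h z))"
  unfolding mem_arc by measurable

lemma indicator_arc_measurable [measurable (raw)]:
  assumes [measurable]: "a \<in> borel_measurable M" "b \<in> borel_measurable M" "c \<in> borel_measurable M"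
  shows "(\<lambda>z. indicator (arc (a z) (b z)) (c z) :: real) \<in> borel_measurable M"
proof -
  have "(\<lambda>z. indicator (arc (a z) (b z)) (c z) :: real) = (\<lambda>z. if c z \<in> arc (a z) (b z) then 1 else 0)"
    by (auto simp: indicator_def)
  then show ?thesis
    by simp
qed

lemma arc_sets [measurable]: "arc l u \<in> sets borel"
  by (simp add: arc_def)

text \<open>Distribution functions measure half-open intervals, and inside a cell only those staying
  strictly away from its ends are controlled. Such intervals exhaust the open cell, so continuity
  from below transfers the bound and leaves atoms at the ends of the cell outside.\<close>

lemma (in finite_measure) measure_open_interval_le:
  fixes h :: "'a \<Rightarrow> real"
  assumes [measurable]: "h \<in> borel_measurable M"
    and le: "\<And>x y. a < x \<Longrightarrow> x < y \<Longrightarrow> y < b \<Longrightarrow> measure M {p\<in>space M. x < h p \<and> h p \<le> y} \<le> c"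
    and "a < b"
  shows "measure M {p\<in>space M. a < h p \<and> h p < b} \<le> c"
proof -
  \<comment> \<open>The shift by 3 keeps \<open>d n\<close> at most a third of the length, so that
    the shrunken interval is never empty.\<close>
  define d where "d n = (b - a) / real (n + 3)" for n
  define S where "S n = {p\<in>space M. a + d n < h p \<and> h p \<le> b - d n}" for n
  have d: "0 < d n" "a + d n < b - d n" "d (Suc n) \<le> d n" for n
  proof -
    have "d n \<le> (b - a) / 3"
      unfolding d_def using \<open>a < b\<close> by (intro divide_left_mono) auto
    then show "a + d n < b - d n"
      using \<open>a < b\<close> by simp
    show "0 < d n" "d (Suc n) \<le> d n"
      unfolding d_def using \<open>a < b\<close> by (auto intro!: divide_left_mono)
  qed
  have "d \<longlonglongrightarrow> 0"
    unfolding d_def by (rule LIMSEQ_ignore_initial_segment[OF lim_const_over_n])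
  have "(\<Union>n. S n) = {p\<in>space M. a < h p \<and> h p < b}"
  proof (intro set_eqI iffI)
    fix p assume "p \<in> {p\<in>space M. a < h p \<and> h p < b}"
    then have p: "p \<in> space M" "0 < min (h p - a) (b - h p)"
      by auto
    then obtain n where "d n < min (h p - a) (b - h p)"
      using order_tendstoD(2)[OF \<open>d \<longlonglongrightarrow> 0\<close> p(2)] by (auto simp: eventually_sequentially)
    then show "p \<in> (\<Union>n. S n)"
      using p by (auto simp: S_def intro!: exI[of _ n])
  next
    fix p assume "p \<in> (\<Union>n. S n)"
    then obtain n where "p \<in> S n" by auto
    then show "p \<in> {p\<in>space M. a < h p \<and> h p < b}"
      using d(1)[of n] by (auto simp: S_def)
  qed
  moreover have "(\<lambda>n. measure M (S n)) \<longlonglongrightarrow> measure M (\<Union>n. S n)"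
  proof (rule finite_Lim_measure_incseq)
    show "range S \<subseteq> sets M"
      unfolding S_def by auto
    show "incseq S"
    proof (rule incseq_SucI)
      show "S n \<subseteq> S (Suc n)" for n
        using d(3)[of n] by (auto simp: S_def)
    qed
  qed
  moreover have "measure M (S n) \<le> c" for n
    unfolding S_def using d[of n] by (intro le) auto
  ultimately show ?thesis
    by (metis (no_types, lifting) LIMSEQ_le_const2)
qed

text \<open>Between consecutive quantiles of the endpoint distributions, the arc rarely has an endpoint;
  if it has none and contains the midpoint of the cell, then it contains the whole cell.\<close>

lemma arc_cell:
  assumes \<mu>: "censor_law \<mu>" and A: "assmA \<mu> s" and ab: "0 \<le> a" "a < b" "b \<le> 2 * pi"
    and L: "\<And>x y. a < x \<Longrightarrow> x < y \<Longrightarrow> y < b \<Longrightarrow> measure \<mu> {p. x < fst p \<and> fst p \<le> y} \<le> s / 8"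
    and U: "\<And>x y. a < x \<Longrightarrow> x < y \<Longrightarrow> y < b \<Longrightarrow> measure \<mu> {p. x < snd p \<and> snd p \<le> y} \<le> s / 8"
  obtains E where "E \<in> sets borel" "3 / 4 * s \<le> measure \<mu> E"
    "\<And>p x. p \<in> E \<Longrightarrow> fst p \<in> circ \<Longrightarrow> snd p \<in> circ \<Longrightarrow> a < x \<Longrightarrow> x < b \<Longrightarrow> x \<in> arc (fst p) (snd p)"
proof -
  have sets_\<mu> [measurable_cong]: "sets \<mu> = sets (borel \<Otimes>\<^sub>M borel)"
    using \<mu> unfolding censor_law_def borel_prod by blast
  have sp: "space \<mu> = UNIV"
    using sets_eq_imp_space_eq[OF sets_\<mu>] by (simp add: space_pair_measure)
  interpret prob_space \<mu>
    using \<mu> by (simp add: censor_law_def)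
  define c where "c = (a + b) / 2"
  define E where "E = {p. c \<in> arc (fst p) (snd p) \<and> \<not> (a < fst p \<and> fst p < b) \<and> \<not> (a < snd p \<and> snd p < b)}"
  have sets_Collect: "{p. P p} \<in> sets \<mu>" if "Measurable.pred \<mu> P" for P
    using that by (simp add: pred_def sp)
  have mL: "{p. a < fst p \<and> fst p < b} \<in> sets \<mu>" and mU: "{p. a < snd p \<and> snd p < b} \<in> sets \<mu>"
    and mE: "E \<in> sets \<mu>" and mc: "{p. c \<in> arc (fst p) (snd p)} \<in> sets \<mu>"
    unfolding E_def by (rule sets_Collect; measurable)+
  have "measure \<mu> {p. a < fst p \<and> fst p < b} \<le> s / 8"
    using measure_open_interval_le[of fst a b "s / 8"] L ab by (simp add: sp)
  moreover have "measure \<mu> {p. a < snd p \<and> snd p < b} \<le> s / 8"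
    using measure_open_interval_le[of snd a b "s / 8"] U ab by (simp add: sp)
  moreover have "s \<le> measure \<mu> {p. c \<in> arc (fst p) (snd p)}"
    using A ab by (auto simp: assmA_def sigma_fun_def c_def circ_def)
  moreover have "measure \<mu> {p. c \<in> arc (fst p) (snd p)} \<le>
      measure \<mu> (E \<union> {p. a < fst p \<and> fst p < b} \<union> {p. a < snd p \<and> snd p < b})"
    using mL mU mE by (intro finite_measure_mono) (auto simp: E_def)
  moreover have "\<dots> \<le> measure \<mu> E + measure \<mu> {p. a < fst p \<and> fst p < b} + measure \<mu> {p. a < snd p \<and> snd p < b}"
    using mL mU mE by (intro order_trans[OF measure_Un_le] add_mono measure_Un_le) auto
  ultimately have "3 / 4 * s \<le> measure \<mu> E"
    by linarith
  moreover have "E \<in> sets borel"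
    using mE \<mu> by (auto simp: censor_law_def)
  moreover have "x \<in> arc (fst p) (snd p)"
    if "p \<in> E" "fst p \<in> circ" "snd p \<in> circ" "a < x" "x < b" for p x
  proof -
    have "a < c" "c < b"
      using ab by (auto simp: c_def)
    \<comment> \<open>Membership in an arc can change only at its endpoints or at the cut 0 = 2 pi,
      and none of these lies strictly between \<open>a\<close> and \<open>b\<close>.\<close>
    then show ?thesis
      using that ab unfolding E_def mem_arc circ_def by (auto split: if_splits)
  qed
  ultimately show thesis
    by (intro that) auto
qed

text \<open>Add the distribution functions of both endpoints and measure the sum \<open>F\<close> in
  units of \<open>s / 8\<close>. The total mass 2 makes \<open>F\<close> range in [0, 16/s], so its
  integer part has at most \<open>nat \<lfloor>16 / s\<rfloor> + 1\<close> values, and between two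
  points with the same integer part both endpoints together have mass at most \<open>s / 8\<close>.
  The level sets of this integer part give the cells; points outside the open cells are infima or
  suprema of level sets, hence finite in number.\<close>

lemma arc_cells:
  assumes \<mu>: "censor_law \<mu>" and A: "assmA \<mu> s"
  obtains E I where "\<And>j. j \<le> nat \<lfloor>16 / s\<rfloor> \<Longrightarrow> E j \<in> sets borel"
    "\<And>j. j \<le> nat \<lfloor>16 / s\<rfloor> \<Longrightarrow> 3 / 4 * s \<le> measure \<mu> (E j)"
    "\<And>j p x. j \<le> nat \<lfloor>16 / s\<rfloor> \<Longrightarrow> p \<in> E j \<Longrightarrow> fst p \<in> circ \<Longrightarrow> snd p \<in> circ \<Longrightarrow> x \<in> I j \<Longrightarrow> x \<in> arc (fst p) (snd p)"
    "finite (circ - (\<Union>j\<le>nat \<lfloor>16 / s\<rfloor>. I j))"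
proof -
  define J where "J = nat \<lfloor>16 / s\<rfloor>"
  have "0 < s"
    using A by (simp add: assmA_def)
  have sets_\<mu> [measurable_cong]: "sets \<mu> = sets (borel \<Otimes>\<^sub>M borel)"
    using \<mu> unfolding censor_law_def borel_prod by blast
  have sp: "space \<mu> = UNIV"
    using sets_eq_imp_space_eq[OF sets_\<mu>] by (simp add: space_pair_measure)
  interpret prob_space \<mu>
    using \<mu> by (simp add: censor_law_def)
  have sets_Collect: "{p. P p} \<in> sets \<mu>" if "Measurable.pred \<mu> P" for P
    using that by (simp add: pred_def sp)
  have m [simp]: "{p. fst p \<le> x} \<in> sets \<mu>" "{p. snd p \<le> x} \<in> sets \<mu>" for x
    by (rule sets_Collect; measurable)+
  define F where "F x = (measure \<mu> {p. fst p \<le> x} + measure \<mu> {p. snd p \<le> x}) / (s / 8)" for x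
  have incr: "measure \<mu> {p. x < fst p \<and> fst p \<le> y} + measure \<mu> {p. x < snd p \<and> snd p \<le> y} = (F y - F x) * (s / 8)"
    if "x \<le> y" for x y
  proof -
    have "{p. x < fst p \<and> fst p \<le> y} = {p. fst p \<le> y} - {p :: real \<times> real. fst p \<le> x}"
      "{p. x < snd p \<and> snd p \<le> y} = {p. snd p \<le> y} - {p :: real \<times> real. snd p \<le> x}"
      by auto
    moreover have "{p :: real \<times> real. fst p \<le> x} \<subseteq> {p. fst p \<le> y}" "{p :: real \<times> real. snd p \<le> x} \<subseteq> {p. snd p \<le> y}"
      using that by auto
    ultimately show ?thesis
      using \<open>0 < s\<close> by (simp add: finite_measure_Diff F_def field_simps)
  qed
  have F_mono: "F x \<le> F y" if "x \<le> y" for x y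
    unfolding F_def using that \<open>0 < s\<close>
    by (intro divide_right_mono add_mono finite_measure_mono) auto
  have F_range: "0 \<le> F x" "F x \<le> 16 / s" for x
  proof -
    show "0 \<le> F x"
      using \<open>0 < s\<close> by (simp add: F_def)
    have "F x \<le> (1 + 1) / (s / 8)"
      unfolding F_def using \<open>0 < s\<close> by (intro divide_right_mono add_mono prob_le_1) auto
    then show "F x \<le> 16 / s" by simp
  qed
  define cell where "cell j = {x \<in> circ. nat \<lfloor>F x\<rfloor> = j}" for j
  \<comment> \<open>Two points strictly inside the hull of a level set are enclosed by members of
    the level set, so monotonicity bounds the increment of \<open>F\<close> between them by
    1.\<close>
  define I where "I j = (if cell j = {} then {} else {Inf (cell j)<..<Sup (cell j)})" for j
  have bdd: "bdd_below (cell j)" "bdd_above (cell j)" for j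
    by (auto simp: cell_def circ_def intro!: bdd_belowI[of _ 0] bdd_aboveI[of _ "2 * pi"])
  have "\<exists>E. E \<in> sets borel \<and> 3 / 4 * s \<le> measure \<mu> E \<and>
      (\<forall>p x. p \<in> E \<longrightarrow> fst p \<in> circ \<longrightarrow> snd p \<in> circ \<longrightarrow> x \<in> I j \<longrightarrow> x \<in> arc (fst p) (snd p))" for j
  proof (cases "cell j \<noteq> {} \<and> Inf (cell j) < Sup (cell j)")
    case True
    have "0 \<le> Inf (cell j)"
      using True by (intro cInf_greatest) (auto simp: cell_def circ_def)
    moreover have "Sup (cell j) \<le> 2 * pi"
      using True by (intro cSup_least) (auto simp: cell_def circ_def)
    moreover have small: "measure \<mu> {p. x < fst p \<and> fst p \<le> y} + measure \<mu> {p. x < snd p \<and> snd p \<le> y} \<le> s / 8"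
      if xy: "Inf (cell j) < x" "x < y" "y < Sup (cell j)" for x y
    proof -
      obtain x' where x': "x' \<in> cell j" "x' < x"
        using True xy cInf_lessD by blast
      obtain y' where y': "y' \<in> cell j" "y < y'"
        using True xy less_cSupD by blast
      have "\<lfloor>F x'\<rfloor> = \<lfloor>F y'\<rfloor>"
        using x' y' F_range[of x'] F_range[of y'] by (auto simp: cell_def eq_nat_nat_iff)
      then have "F y' - F x' \<le> 1"
        by linarith
      then have "F y - F x \<le> 1"
        using F_mono[of x' x] F_mono[of y y'] x' y' by simp
      then have "(F y - F x) * (s / 8) \<le> 1 * (s / 8)"
        using \<open>0 < s\<close> by (intro mult_right_mono) auto
      then show ?thesis
        using incr[of x y] xy by simp
    qed
    moreover have "measure \<mu> {p. x < fst p \<and> fst p \<le> y} \<le> s / 8" "measure \<mu> {p. x < snd p \<and> snd p \<le> y} \<le> s / 8"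
      if "Inf (cell j) < x" "x < y" "y < Sup (cell j)" for x y
      using small[OF that] measure_nonneg[of \<mu>] by (smt (verit))+
    ultimately obtain E where "E \<in> sets borel" "3 / 4 * s \<le> measure \<mu> E"
      "\<And>p x. p \<in> E \<Longrightarrow> fst p \<in> circ \<Longrightarrow> snd p \<in> circ \<Longrightarrow> Inf (cell j) < x \<Longrightarrow> x < Sup (cell j) \<Longrightarrow> x \<in> arc (fst p) (snd p)"
      using True by (rule_tac arc_cell[OF \<mu> A, of "Inf (cell j)" "Sup (cell j)"]) auto
    then show ?thesis
      by (intro exI[of _ E]) (use True in \<open>auto simp: I_def\<close>)
  next
    case False
    \<comment> \<open>A level set that is empty or a single point has an empty open cell, so the
      whole space serves as \<open>E\<close>; its mass 1 is large enough because \<open>s\<close> is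
      below a probability.\<close>
    have "s \<le> sigma_fun \<mu> 0"
      using A by (auto simp: assmA_def circ_def)
    also have "\<dots> \<le> 1"
      by (simp add: sigma_fun_def)
    finally have "3 / 4 * s \<le> measure \<mu> UNIV"
      using prob_space \<open>0 < s\<close> by (simp add: sp)
    moreover have "I j = {}"
      using False by (auto simp: I_def)
    ultimately show ?thesis
      by (intro exI[of _ UNIV]) auto
  qed
  then obtain E where "\<And>j. E j \<in> sets borel" "\<And>j. 3 / 4 * s \<le> measure \<mu> (E j)"
      "\<And>j p x. p \<in> E j \<Longrightarrow> fst p \<in> circ \<Longrightarrow> snd p \<in> circ \<Longrightarrow> x \<in> I j \<Longrightarrow> x \<in> arc (fst p) (snd p)"
    by metis
  moreover have "finite (circ - (\<Union>j\<le>J. I j))"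
  proof (rule finite_subset)
    show "circ - (\<Union>j\<le>J. I j) \<subseteq> (\<Union>j\<le>J. {Inf (cell j), Sup (cell j)})"
    proof
      fix x assume x: "x \<in> circ - (\<Union>j\<le>J. I j)"
      define j where "j = nat \<lfloor>F x\<rfloor>"
      have "j \<le> J"
        unfolding j_def J_def using F_range[of x] by (intro nat_mono floor_mono)
      moreover have "x \<in> cell j"
        using x by (simp add: cell_def j_def)
      then have "Inf (cell j) \<le> x" "x \<le> Sup (cell j)"
        using bdd by (auto intro: cInf_lower cSup_upper)
      moreover have "x \<notin> I j"
        using x \<open>j \<le> J\<close> by auto
      ultimately show "x \<in> (\<Union>j\<le>J. {Inf (cell j), Sup (cell j)})"
        using \<open>x \<in> cell j\<close> by (auto simp: I_def intro!: bexI[of _ j] split: if_splits)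
    qed
  qed auto
  ultimately show thesis
    unfolding J_def by (intro that[of E I]) auto
qed

section \<open>Independent samples\<close>

text \<open>The joint law of the coordinates is the product measure itself, hence the product of its
  marginals. The criterion applied here asks for a nonempty index set, which is why
  \<open>n = 0\<close> is separate.\<close>

lemma indep_vars_PiM_coordinates:
  assumes Q: "prob_space Q"
  shows "prob_space.indep_vars (PiM {..<n::nat} (\<lambda>_. Q)) (\<lambda>_. Q) (\<lambda>i \<omega>. \<omega> i) {..<n}"
proof (cases "n = 0")
  case True
  interpret prob_space "PiM {..<n} (\<lambda>_. Q)"
    by (intro prob_space_PiM Q)
  show ?thesis
    unfolding indep_vars_def indep_sets_def using True by auto
next
  case False
  let ?P = "PiM {..<n} (\<lambda>_. Q)"
  interpret prob_space ?P
    by (intro prob_space_PiM Q)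
  have "distr ?P ?P (\<lambda>x. \<lambda>i\<in>{..<n}. x i) = distr ?P ?P (\<lambda>x. x)"
    by (intro distr_cong) (auto simp: space_PiM)
  also have "\<dots> = ?P"
    by (rule distr_id2) simp
  also have "\<dots> = PiM {..<n} (\<lambda>i. distr ?P Q (\<lambda>\<omega>. \<omega> i))"
    using distr_PiM_component[of "{..<n}" "\<lambda>_. Q"] Q by (intro PiM_cong refl) simp
  finally show ?thesis
    using False by (subst indep_vars_iff_distr_eq_PiM') auto
qed

lemma integral_PiM_coordinate:
  fixes h :: "'a \<Rightarrow> real"
  assumes Q: "prob_space Q" and h: "h \<in> borel_measurable Q" and i: "i < (n::nat)"
  shows "(LINT \<omega>|PiM {..<n} (\<lambda>_. Q). h (\<omega> i)) = integral\<^sup>L Q h"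
proof -
  have "integral\<^sup>L Q h = integral\<^sup>L (distr (PiM {..<n} (\<lambda>_. Q)) Q (\<lambda>\<omega>. \<omega> i)) h"
    using i Q by (subst distr_PiM_component) auto
  also have "\<dots> = (LINT \<omega>|PiM {..<n} (\<lambda>_. Q). h (\<omega> i))"
    using i h by (intro integral_distr) auto
  finally show ?thesis ..
qed

text \<open>In the expanded square the off-diagonal terms vanish by independence and centring; the
  \<open>n\<close> diagonal terms are each at most \<open>c\<^sup>2\<close>.\<close>

lemma iid_centered_second_moment:
  fixes h :: "'a \<Rightarrow> real"
  assumes Q: "prob_space Q" and h [measurable]: "h \<in> borel_measurable Q"
    and bd: "\<And>x. \<bar>h x\<bar> \<le> c" and mean: "integral\<^sup>L Q h = 0"
  shows "(\<integral>\<^sup>+ \<omega>. ennreal ((\<Sum>i<n. h (\<omega> i))\<^sup>2) \<partial>PiM {..<n::nat} (\<lambda>_. Q)) \<le> ennreal (real n * c\<^sup>2)"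
proof -
  let ?P = "PiM {..<n} (\<lambda>_. Q)"
  interpret prob_space ?P
    by (intro prob_space_PiM Q)
  have m [measurable]: "i < n \<Longrightarrow> (\<lambda>\<omega>. h (\<omega> i)) \<in> borel_measurable ?P" for i
    by simp
  have c: "0 \<le> c"
    using bd[of undefined] by linarith
  have int: "integrable ?P (\<lambda>\<omega>. h (\<omega> i) * h (\<omega> j))" if "i < n" "j < n" for i j
    using that by (intro integrable_const_bound[of _ "c * c"]) (auto simp: abs_mult intro!: mult_mono bd c)
  have ind: "indep_vars (\<lambda>_. borel) (\<lambda>i \<omega>. h (\<omega> i)) {..<n}"
    by (rule indep_vars_compose2[OF indep_vars_PiM_coordinates[OF Q]]) simp
  have off: "(LINT \<omega>|?P. h (\<omega> i) * h (\<omega> j)) = 0" if "i < n" "j < n" "i \<noteq> j" for i j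
  proof -
    have "(LINT \<omega>|?P. (\<Prod>k\<in>{i,j}. h (\<omega> k))) = (\<Prod>k\<in>{i,j}. LINT \<omega>|?P. h (\<omega> k))"
      using that by (intro indep_vars_lebesgue_integral indep_vars_subset[OF ind])
        (auto intro!: integrable_const_bound[of _ c] bd)
    then show ?thesis
      using that by (simp add: integral_PiM_coordinate[OF Q h] mean)
  qed
  have diag: "(LINT \<omega>|?P. h (\<omega> i) * h (\<omega> i)) \<le> c\<^sup>2" if "i < n" for i
  proof -
    have "(LINT \<omega>|?P. h (\<omega> i) * h (\<omega> i)) \<le> (LINT \<omega>|?P. c\<^sup>2)"
      using bd by (intro integral_mono int that)
        (auto simp: power2_eq_square[symmetric] abs_le_square_iff[symmetric] c)
    then show ?thesis
      by (simp add: prob_space)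
  qed
  have "(\<integral>\<^sup>+ \<omega>. ennreal ((\<Sum>i<n. h (\<omega> i))\<^sup>2) \<partial>?P) = (\<integral>\<^sup>+ \<omega>. ennreal (\<Sum>i<n. \<Sum>j<n. h (\<omega> i) * h (\<omega> j)) \<partial>?P)"
    by (simp add: power2_eq_square sum_product)
  also have "\<dots> = ennreal (LINT \<omega>|?P. (\<Sum>i<n. \<Sum>j<n. h (\<omega> i) * h (\<omega> j)))"
    by (intro nn_integral_eq_integral Bochner_Integration.integrable_sum int) (auto simp: sum_product[symmetric])
  also have "(LINT \<omega>|?P. (\<Sum>i<n. \<Sum>j<n. h (\<omega> i) * h (\<omega> j))) = (\<Sum>i<n. \<Sum>j<n. LINT \<omega>|?P. h (\<omega> i) * h (\<omega> j))"
    by (subst Bochner_Integration.integral_sum, force intro!: Bochner_Integration.integrable_sum int,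
        intro sum.cong refl Bochner_Integration.integral_sum int) auto
  also have "\<dots> \<le> (\<Sum>i<n. c\<^sup>2)"
  proof (rule sum_mono)
    fix i assume i: "i \<in> {..<n}"
    have "(\<Sum>j<n. LINT \<omega>|?P. h (\<omega> i) * h (\<omega> j)) = (\<Sum>j\<in>{i}. LINT \<omega>|?P. h (\<omega> i) * h (\<omega> j))"
      using i off by (intro sum.mono_neutral_right) auto
    then show "(\<Sum>j<n. LINT \<omega>|?P. h (\<omega> i) * h (\<omega> j)) \<le> c\<^sup>2"
      using diag i by simp
  qed
  finally show ?thesis
    by (simp add: ennreal_leI)
qed

text \<open>Hoeffding for \<open>n\<close> variables in [0, 1] at deviation n t: the exponent is -2
  (n t)^2 / n.\<close>

lemma iid_frequency_lower_tail:
  assumes Q: "prob_space Q" and E [measurable]: "E \<in> sets Q" and n: "0 < (n::nat)" and t: "0 \<le> t"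
  shows "measure (PiM {..<n} (\<lambda>_. Q)) {\<omega> \<in> space (PiM {..<n} (\<lambda>_. Q)).
      (\<Sum>i<n. indicator E (\<omega> i)) \<le> real n * (measure Q E - t)} \<le> exp (- 2 * real n * t\<^sup>2)"
proof -
  let ?P = "PiM {..<n} (\<lambda>_. Q)"
  interpret Q: prob_space Q by fact
  interpret prob_space ?P
    by (intro prob_space_PiM Q)
  interpret Hoeffding_ineq ?P "{..<n}" "\<lambda>i \<omega>. indicator E (\<omega> i)" "\<lambda>_. 0" "\<lambda>_. 1"
      "\<Sum>i<n. expectation (\<lambda>\<omega>. indicator E (\<omega> i))"
  proof unfold_locales
    show "indep_vars (\<lambda>_. borel) (\<lambda>i \<omega>. indicator E (\<omega> i) :: real) {..<n}"
      by (rule indep_vars_compose2[OF indep_vars_PiM_coordinates[OF Q]]) simp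
  qed (auto simp: indicator_def)
  have "(\<Sum>i<n. expectation (\<lambda>\<omega>. indicator E (\<omega> i) :: real)) = (\<Sum>i<n. measure Q E)"
    by (intro sum.cong refl, subst integral_PiM_coordinate[OF Q]) auto
  then show ?thesis
    using Hoeffding_ineq_le[of "real n * t"] n t
    by (simp add: right_diff_distrib power_mult_distrib power2_eq_square mult_ac)
qed

section \<open>Square linear systems\<close>

text \<open>Gaussian elimination: an equation with a nonzero coefficient at \<open>p\<close> is
  solved for the unknown \<open>p\<close> and substituted into the others, which removes one
  equation and one unknown.\<close>

lemma homogeneous_system_nontrivial:
  fixes H :: "'k \<Rightarrow> 'l \<Rightarrow> real"
  assumes "finite K" "finite I" "card K < card I"
  shows "\<exists>a. (\<exists>l\<in>I. a l \<noteq> 0) \<and> (\<forall>k\<in>K. (\<Sum>l\<in>I. H k l * a l) = 0)"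
  using assms
proof (induction K arbitrary: I H rule: finite_induct)
  case empty
  then have "I \<noteq> {}" by auto
  then show ?case by (auto intro!: exI[of _ "\<lambda>_. 1"])
next
  case (insert k K)
  show ?case
  proof (cases "\<forall>l\<in>I. H k l = 0")
    case True
    have "card K < card I"
      using insert by simp
    then obtain a where "\<exists>l\<in>I. a l \<noteq> 0" "\<forall>k\<in>K. (\<Sum>l\<in>I. H k l * a l) = 0"
      using insert.IH[of I H] insert.prems by auto
    then show ?thesis
      using True by (intro exI[of _ a]) auto
  next
    case False
    then obtain p where p: "p \<in> I" "H k p \<noteq> 0" by auto
    define I' where "I' = I - {p}"
    have I': "finite I'" "card K < card I'" "I = insert p I'" "p \<notin> I'"
      using insert p by (auto simp: I'_def)
    obtain a where a: "\<exists>l\<in>I'. a l \<noteq> 0"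
        "\<forall>i\<in>K. (\<Sum>l\<in>I'. (H i l - H i p * H k l / H k p) * a l) = 0"
      using insert.IH[of I' "\<lambda>i l. H i l - H i p * H k l / H k p"] I' by auto
    \<comment> \<open>The value at \<open>p\<close> is the one that equation \<open>k\<close>
      forces.\<close>
    define b where "b = a(p := - (\<Sum>l\<in>I'. H k l * a l) / H k p)"
    have b: "(\<Sum>l\<in>I. H i l * b l) = (\<Sum>l\<in>I'. H i l * a l) - H i p * (\<Sum>l\<in>I'. H k l * a l) / H k p" for i
    proof -
      have "(\<Sum>l\<in>I'. H i l * b l) = (\<Sum>l\<in>I'. H i l * a l)"
        using I'(4) by (intro sum.cong) (auto simp: b_def)
      then show ?thesis
        using I' by (simp add: b_def)
    qed
    have "(\<Sum>l\<in>I. H i l * b l) = 0" if "i \<in> K" for i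
    proof -
      have "(\<Sum>l\<in>I'. (H i l - H i p * H k l / H k p) * a l)
          = (\<Sum>l\<in>I'. H i l * a l) - H i p * (\<Sum>l\<in>I'. H k l * a l) / H k p"
        by (simp add: sum_subtractf sum_distrib_left sum_divide_distrib algebra_simps)
      then show ?thesis
        using a(2) that b by simp
    qed
    moreover have "(\<Sum>l\<in>I. H k l * b l) = 0"
      using b[of k] p by simp
    moreover have "\<exists>l\<in>I. b l \<noteq> 0"
      using a(1) I' by (auto simp: b_def)
    ultimately show ?thesis
      by (intro exI[of _ b]) auto
  qed
qed

text \<open>For existence, append the column \<open>- u\<close> as an extra unknown: N + 1 equations
  in N + 2 unknowns have a nontrivial solution, injectivity prevents its last entry from being 0,
  and dividing by that entry solves the original system.\<close>

lemma injective_system_ex1: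
  fixes G :: "nat \<Rightarrow> nat \<Rightarrow> real"
  assumes inj: "\<And>a. (\<And>k. k \<le> N \<Longrightarrow> (\<Sum>l\<le>N. G k l * a l) = 0) \<Longrightarrow> (\<And>l. l \<le> N \<Longrightarrow> a l = 0)"
  shows "\<exists>!a. (\<forall>k\<le>N. (\<Sum>l\<le>N. G k l * a l) = u k) \<and> (\<forall>k>N. a k = 0)"
proof (rule ex_ex1I)
  define H where "H k l = (if l \<le> N then G k l else - u k)" for k l
  obtain a where a: "\<exists>l\<in>{..Suc N}. a l \<noteq> 0" "\<forall>k\<in>{..N}. (\<Sum>l\<le>Suc N. H k l * a l) = 0"
    using homogeneous_system_nontrivial[of "{..N}" "{..Suc N}" H] by auto
  have eq: "(\<Sum>l\<le>N. G k l * a l) = u k * a (Suc N)" if "k \<le> N" for k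
  proof -
    have "(\<Sum>l\<le>N. H k l * a l) = (\<Sum>l\<le>N. G k l * a l)"
      by (intro sum.cong) (auto simp: H_def)
    moreover have "(\<Sum>l\<le>N. H k l * a l) + H k (Suc N) * a (Suc N) = 0"
      using a(2) that by simp
    ultimately show ?thesis
      by (simp add: H_def)
  qed
  have "a (Suc N) \<noteq> 0"
  proof
    assume 0: "a (Suc N) = 0"
    have "a l = 0" if "l \<le> N" for l
      using eq 0 that by (intro inj[of a]) auto
    then show False
      using a(1) 0 by (auto simp: le_Suc_eq)
  qed
  define b where "b l = (if l \<le> N then a l / a (Suc N) else 0)" for l
  have "(\<Sum>l\<le>N. G k l * b l) = u k" if "k \<le> N" for k
  proof -
    have "(\<Sum>l\<le>N. G k l * b l) = (\<Sum>l\<le>N. G k l * a l) / a (Suc N)"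
      by (simp add: b_def sum_divide_distrib)
    then show ?thesis
      using eq[OF that] \<open>a (Suc N) \<noteq> 0\<close> by simp
  qed
  then show "\<exists>a. (\<forall>k\<le>N. (\<Sum>l\<le>N. G k l * a l) = u k) \<and> (\<forall>k>N. a k = 0)"
    by (intro exI[of _ b]) (auto simp: b_def)
next
  fix a b
  assume a: "(\<forall>k\<le>N. (\<Sum>l\<le>N. G k l * a l) = u k) \<and> (\<forall>k>N. a k = 0)"
    and b: "(\<forall>k\<le>N. (\<Sum>l\<le>N. G k l * b l) = u k) \<and> (\<forall>k>N. b k = 0)"
  have "a l - b l = 0" if "l \<le> N" for l
    using a b that by (intro inj[of "\<lambda>l. a l - b l"]) (auto simp: right_diff_distrib sum_subtractf)
  then show "a = b"
    using a b by (metis eq_iff_diff_eq_0 ext not_le)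
qed

section \<open>Least squares for a fixed sample\<close>

definition sigma_hat :: "nat \<Rightarrow> (nat \<Rightarrow> real \<times> real \<times> real) \<Rightarrow> real \<Rightarrow> real" where
  "sigma_hat n \<omega> x = (1 / real n) * (\<Sum>i<n. indicator (arc (Ls \<omega> i) (Us \<omega> i)) x)"

lemma sigma_hat_measurable [measurable]: "sigma_hat n \<omega> \<in> borel_measurable circM"
  unfolding sigma_hat_def[abs_def] by (intro borel_measurable_circM) measurable

lemma sigma_hat_range: "0 \<le> sigma_hat n \<omega> x" "sigma_hat n \<omega> x \<le> 1"
proof -
  show "0 \<le> sigma_hat n \<omega> x"
    by (simp add: sigma_hat_def sum_nonneg)
  have "(\<Sum>i<n. indicator (arc (Ls \<omega> i) (Us \<omega> i)) x) \<le> (\<Sum>i<n. 1 :: real)"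
    by (intro sum_mono) (auto simp: indicator_def)
  then show "sigma_hat n \<omega> x \<le> 1"
    by (cases "n = 0") (auto simp: sigma_hat_def field_simps)
qed

lemma L2_mult_bounded:
  assumes "L2 g" "w \<in> borel_measurable circM" "\<And>x. 0 \<le> w x" "\<And>x. w x \<le> 1"
  shows "L2 (\<lambda>x. g x * w x)"
  unfolding L2_def
proof
  show m: "(\<lambda>x. g x * w x) \<in> borel_measurable circM"
    using assms by measurable
  show "integrable circM (\<lambda>x. (g x * w x)\<^sup>2)"
  proof (rule Bochner_Integration.integrable_bound)
    show "integrable circM (\<lambda>x. (g x)\<^sup>2)"
      using assms by (simp add: L2_def)
    show "AE x in circM. norm ((g x * w x)\<^sup>2) \<le> norm ((g x)\<^sup>2)"
      using assms(3,4) by (auto simp: power_mult_distrib intro!: mult_left_le power_le_one)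
  qed (use m in measurable)
qed

lemma L2_mult_sigma_hat: "L2 g \<Longrightarrow> L2 (\<lambda>x. g x * sigma_hat n \<omega> x)"
  by (intro L2_mult_bounded sigma_hat_range) auto

lemma integral_mult_sigma_hat:
  assumes "integrable circM g"
  shows "integral\<^sup>L circM (\<lambda>x. g x * sigma_hat n \<omega> x)
    = (1 / real n) * (\<Sum>i<n. integral\<^sup>L circM (\<lambda>x. g x * indicator (arc (Ls \<omega> i) (Us \<omega> i)) x))"
proof -
  have "arc l u \<inter> circ \<in> sets circM" for l u
    by (simp add: circM_def sets_restrict_space_iff)
  then have int: "integrable circM (\<lambda>x. g x * indicator (arc l u) x)" for l u
    using integrable_mult_indicator[OF _ assms, of "arc l u \<inter> circ"]
    by (subst Bochner_Integration.integrable_cong[OF refl, where g = "\<lambda>x. indicator (arc l u \<inter> circ) x *\<^sub>R g x"])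
       (auto simp: indicator_def)
  have "integral\<^sup>L circM (\<lambda>x. g x * sigma_hat n \<omega> x)
      = integral\<^sup>L circM (\<lambda>x. (1 / real n) * (\<Sum>i<n. g x * indicator (arc (Ls \<omega> i) (Us \<omega> i)) x))"
    by (simp only: sigma_hat_def sum_distrib_left mult.left_commute)
  also have "\<dots> = (1 / real n) * (\<Sum>i<n. integral\<^sup>L circM (\<lambda>x. g x * indicator (arc (Ls \<omega> i) (Us \<omega> i)) x))"
    by (subst integral_mult_right_zero, subst Bochner_Integration.integral_sum) (auto intro: int)
  finally show ?thesis .
qed

lemma Ghat_eq_integral:
  assumes "\<forall>i<n. Ls \<omega> i \<in> circ \<and> Us \<omega> i \<in> circ"
  shows "Ghat n \<omega> k l = integral\<^sup>L circM (\<lambda>x. phi k x * phi l x * sigma_hat n \<omega> x)"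
proof -
  have "(LINT x:arc (Ls \<omega> i) (Us \<omega> i)|lborel. phi k x * phi l x)
      = integral\<^sup>L circM (\<lambda>x. phi k x * phi l x * indicator (arc (Ls \<omega> i) (Us \<omega> i)) x)" if "i < n" for i
    unfolding set_integral_circ[symmetric] set_lebesgue_integral_def
    using arc_subset_circ assms that
    by (intro Bochner_Integration.integral_cong) (auto simp: indicator_def)
  then show ?thesis
    by (simp add: Ghat_def integral_mult_sigma_hat L2_mult_integrable L2_phi)
qed

text \<open>Applying row \<open>k\<close> of \<open>Ghat\<close> to \<open>a\<close> gives the
  coefficient \<open>k\<close> of \<open>trig m a\<close> weighted by the empirical coverage, so
  \<open>Ghat\<close> is the Gram matrix of a weighted inner product.\<close>

lemma Ghat_bilinear:
  assumes "\<forall>i<n. Ls \<omega> i \<in> circ \<and> Us \<omega> i \<in> circ"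
  shows "(\<Sum>k\<le>2*m. b k * (\<Sum>l\<le>2*m. Ghat n \<omega> k l * a l)) = integral\<^sup>L circM (\<lambda>x. trig m a x * sigma_hat n \<omega> x * trig m b x)"
proof -
  have "(\<Sum>l\<le>2*m. Ghat n \<omega> k l * a l) = coeff (\<lambda>x. trig m a x * sigma_hat n \<omega> x) k" for k
  proof -
    have "coeff (\<lambda>x. trig m a x * sigma_hat n \<omega> x) k = integral\<^sup>L circM (\<lambda>x. phi k x * sigma_hat n \<omega> x * trig m a x)"
      by (simp add: coeff_circM mult_ac)
    also have "\<dots> = (\<Sum>l\<le>2*m. a l * coeff (\<lambda>x. phi k x * sigma_hat n \<omega> x) l)"
      by (intro integral_mult_trig L2_mult_sigma_hat L2_phi)
    finally show ?thesis
      by (simp add: Ghat_eq_integral[OF assms] coeff_circM mult_ac)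
  qed
  then show ?thesis
    by (simp add: integral_mult_trig L2_mult_sigma_hat L2_trig)
qed

lemma sigma_hat_quadratic_lower:
  assumes "AE x in circM. c \<le> sigma_hat n \<omega> x"
  shows "c * (\<Sum>k\<le>2*m. (a k)\<^sup>2) \<le> integral\<^sup>L circM (\<lambda>x. trig m a x * sigma_hat n \<omega> x * trig m a x)"
proof -
  have "integral\<^sup>L circM (\<lambda>x. c * (trig m a x)\<^sup>2) \<le> integral\<^sup>L circM (\<lambda>x. trig m a x * sigma_hat n \<omega> x * trig m a x)"
  proof (rule integral_mono_AE)
    show "integrable circM (\<lambda>x. c * (trig m a x)\<^sup>2)"
      using L2_trig[of m a] by (auto simp: L2_def)
    show "integrable circM (\<lambda>x. trig m a x * sigma_hat n \<omega> x * trig m a x)"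
      by (intro L2_mult_integrable L2_mult_sigma_hat L2_trig)
    show "AE x in circM. c * (trig m a x)\<^sup>2 \<le> trig m a x * sigma_hat n \<omega> x * trig m a x"
      using assms
    proof eventually_elim
      case (elim x)
      then have "c * (trig m a x)\<^sup>2 \<le> sigma_hat n \<omega> x * (trig m a x)\<^sup>2"
        by (intro mult_right_mono) auto
      then show ?case
        by (simp add: power2_eq_square mult_ac)
    qed
  qed
  then show ?thesis
    by (simp add: norm_trig)
qed

text \<open>Here the definite description in \<open>ahat\<close> acquires its meaning: coverage
  bounded below makes the quadratic form positive definite, so the system is injective and has
  exactly one solution.\<close>

lemma ahat_normal_equations:
  assumes circ: "\<forall>i<n. Ls \<omega> i \<in> circ \<and> Us \<omega> i \<in> circ"
    and low: "AE x in circM. c \<le> sigma_hat n \<omega> x" and "0 < c" and "k \<le> 2 * m"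
  shows "(\<Sum>l\<le>2*m. Ghat n \<omega> k l * ahat n m \<omega> l) = Uhat n \<omega> k"
proof -
  have "\<exists>!a. (\<forall>k\<le>2*m. (\<Sum>l\<le>2*m. Ghat n \<omega> k l * a l) = Uhat n \<omega> k) \<and> (\<forall>k>2*m. a k = 0)"
  proof (rule injective_system_ex1)
    fix a l assume 0: "\<And>k. k \<le> 2 * m \<Longrightarrow> (\<Sum>l\<le>2*m. Ghat n \<omega> k l * a l) = 0" and l: "l \<le> 2 * m"
    have "c * (\<Sum>k\<le>2*m. (a k)\<^sup>2) \<le> (\<Sum>k\<le>2*m. a k * (\<Sum>l\<le>2*m. Ghat n \<omega> k l * a l))"
      unfolding Ghat_bilinear[OF circ] by (rule sigma_hat_quadratic_lower[OF low])
    also have "\<dots> = 0"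
      using 0 by simp
    finally have "(\<Sum>k\<le>2*m. (a k)\<^sup>2) \<le> 0"
      using \<open>0 < c\<close> by (simp add: mult_le_0_iff)
    then have "(\<Sum>k\<le>2*m. (a k)\<^sup>2) = 0"
      by (intro antisym sum_nonneg) auto
    then show "a l = 0"
      using l by (simp add: sum_nonneg_eq_0_iff)
  qed
  from theI'[OF this] show ?thesis
    unfolding ahat_def[symmetric] using \<open>k \<le> 2 * m\<close> by blast
qed

text \<open>Young's inequality on both error terms absorbs half of the quadratic form.\<close>

lemma estimation_error_deterministic:
  assumes circ: "\<forall>i<n. Ls \<omega> i \<in> circ \<and> Us \<omega> i \<in> circ"
    and low: "AE x in circM. s / 2 \<le> sigma_hat n \<omega> x" and "0 < s" and f: "L2 f"
    and \<nu>: "\<And>k. \<nu> k = Uhat n \<omega> k - integral\<^sup>L circM (\<lambda>x. f x * phi k x * sigma_hat n \<omega> x)"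
  shows "(\<Sum>k\<le>2*m. (ahat n m \<omega> k - coeff f k)\<^sup>2)
    \<le> 8 / s\<^sup>2 * ((\<Sum>k\<le>2*m. (\<nu> k)\<^sup>2) + integral\<^sup>L circM (\<lambda>x. (proj m f x - f x)\<^sup>2))"
proof -
  let ?w = "sigma_hat n \<omega>" and ?d = "\<lambda>k. ahat n m \<omega> k - coeff f k"
  let ?t = "trig m ?d" and ?r = "\<lambda>x. f x - proj m f x"
  define D where "D = (\<Sum>k\<le>2*m. (?d k)\<^sup>2)"
  define N where "N = (\<Sum>k\<le>2*m. (\<nu> k)\<^sup>2)"
  define R where "R = integral\<^sup>L circM (\<lambda>x. (proj m f x - f x)\<^sup>2)"
  \<comment> \<open>The first weight is chosen so that two applications use \<open>s / 8 * D\<close>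
    each of the available \<open>s / 2 * D\<close>. The remaining \<open>s / 4\<close> divides the
    second weight \<open>2 / s\<close>, which produces 8/s^2.\<close>
  have young: "a * b \<le> s / 8 * a\<^sup>2 + 2 / s * b\<^sup>2" for a b :: real
  proof -
    have "s / 8 * a\<^sup>2 + 2 / s * b\<^sup>2 - a * b = s / 8 * (a - 4 / s * b)\<^sup>2"
      using \<open>0 < s\<close> by (simp add: power2_eq_square field_simps)
    also have "\<dots> \<ge> 0"
      using \<open>0 < s\<close> by simp
    finally show ?thesis
      by simp
  qed
  have Lr: "L2 ?r"
    unfolding proj_eq_trig by (intro L2_diff f L2_trig)
  have R: "integral\<^sup>L circM (\<lambda>x. (?r x)\<^sup>2) = R"
    by (simp add: R_def power2_commute)
  have "s / 2 * D \<le> integral\<^sup>L circM (\<lambda>x. ?t x * ?w x * ?t x)"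
    unfolding D_def by (rule sigma_hat_quadratic_lower[OF low])
  \<comment> \<open>Inserting \<open>f\<close> between the estimator and the projection separates
    the stochastic part, which the normal equations turn into \<open>\<nu>\<close>, from the bias
    part \<open>f - proj m f\<close>.\<close>
  also have "\<dots> = integral\<^sup>L circM (\<lambda>x. trig m (ahat n m \<omega>) x * ?w x * ?t x - f x * ?w x * ?t x + ?r x * ?w x * ?t x)"
    by (intro Bochner_Integration.integral_cong refl)
       (simp add: proj_eq_trig trig_diff[symmetric] algebra_simps)
  also have "\<dots> = integral\<^sup>L circM (\<lambda>x. trig m (ahat n m \<omega>) x * ?w x * ?t x)
      - integral\<^sup>L circM (\<lambda>x. f x * ?w x * ?t x) + integral\<^sup>L circM (\<lambda>x. ?r x * ?w x * ?t x)"
  proof -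
    have "integrable circM (\<lambda>x. g x * ?w x * ?t x)" if "L2 g" for g
      by (intro L2_mult_integrable L2_mult_sigma_hat L2_trig that)
    from this[OF L2_trig] this[OF f] this[OF Lr] show ?thesis
      by (simp only: Bochner_Integration.integral_add Bochner_Integration.integral_diff Bochner_Integration.integrable_diff)
  qed
  also have "integral\<^sup>L circM (\<lambda>x. trig m (ahat n m \<omega>) x * ?w x * ?t x) = (\<Sum>k\<le>2*m. ?d k * Uhat n \<omega> k)"
    unfolding Ghat_bilinear[OF circ, symmetric]
    using ahat_normal_equations[OF circ low] \<open>0 < s\<close> by simp
  also have "integral\<^sup>L circM (\<lambda>x. f x * ?w x * ?t x) = (\<Sum>k\<le>2*m. ?d k * integral\<^sup>L circM (\<lambda>x. f x * phi k x * ?w x))"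
    by (simp only: integral_mult_trig[OF L2_mult_sigma_hat[OF f]]) (simp only: coeff_circM mult_ac)
  also have "(\<Sum>k\<le>2*m. ?d k * Uhat n \<omega> k) - (\<Sum>k\<le>2*m. ?d k * integral\<^sup>L circM (\<lambda>x. f x * phi k x * ?w x))
      = (\<Sum>k\<le>2*m. ?d k * \<nu> k)"
    by (simp add: \<nu> sum_subtractf right_diff_distrib)
  also have "\<dots> \<le> (\<Sum>k\<le>2*m. s / 8 * (?d k)\<^sup>2 + 2 / s * (\<nu> k)\<^sup>2)"
    by (intro sum_mono young)
  also have "\<dots> = s / 8 * D + 2 / s * N"
    by (simp add: D_def N_def sum.distrib sum_distrib_left)
  also have "integral\<^sup>L circM (\<lambda>x. ?r x * ?w x * ?t x) \<le> integral\<^sup>L circM (\<lambda>x. s / 8 * (?t x)\<^sup>2 + 2 / s * (?r x)\<^sup>2)"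
  proof (rule integral_mono)
    show "integrable circM (\<lambda>x. ?r x * ?w x * ?t x)"
      by (intro L2_mult_integrable L2_mult_sigma_hat L2_trig Lr)
    show "integrable circM (\<lambda>x. s / 8 * (?t x)\<^sup>2 + 2 / s * (?r x)\<^sup>2)"
      using Lr L2_trig[of m ?d] by (simp add: L2_def)
    fix x
    have "?r x * ?w x * ?t x \<le> s / 8 * (?t x)\<^sup>2 + 2 / s * (?r x * ?w x)\<^sup>2"
      using young[of "?t x" "?r x * ?w x"] by (simp only: mult.commute[of "?t x"])
    also have "(?r x * ?w x)\<^sup>2 \<le> (?r x)\<^sup>2"
      using sigma_hat_range[of n \<omega> x] by (auto simp: power_mult_distrib intro!: mult_left_le power_le_one)
    finally show "?r x * ?w x * ?t x \<le> s / 8 * (?t x)\<^sup>2 + 2 / s * (?r x)\<^sup>2"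
      using \<open>0 < s\<close> by (simp add: mult_left_mono divide_right_mono)
  qed
  also have "\<dots> = s / 8 * D + 2 / s * R"
    using Lr L2_trig[of m ?d] R by (simp add: L2_def norm_trig D_def)
  finally have "s / 2 * D \<le> s / 8 * D + 2 / s * N + (s / 8 * D + 2 / s * R)"
    by simp
  moreover have "D * (s / 4) = s / 2 * D - s / 8 * D - s / 8 * D" "2 / s * (N + R) = 2 / s * N + 2 / s * R"
    by (simp_all add: distrib_left)
  ultimately have "D * (s / 4) \<le> 2 / s * (N + R)"
    by linarith
  then have "D * (s / 4) / (s / 4) \<le> 2 / s * (N + R) / (s / 4)"
    using \<open>0 < s\<close> by (intro divide_right_mono) auto
  then show ?thesis
    unfolding D_def[symmetric] N_def[symmetric] R_def[symmetric]
    using \<open>0 < s\<close> by (simp add: power2_eq_square)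
qed

section \<open>The effect of the truncation on the loss\<close>

lemma fring_eq_trig: "fring n m \<omega> = trig m (ahat n m \<omega>)"
  by (simp add: fun_eq_iff fring_def trig_def)

text \<open>This holds for every sample, even where \<open>Ghat\<close> is singular and
  \<open>ahat\<close> is unspecified: \<open>fring\<close> is a trigonometric polynomial in any
  case, and the cut-off bounds its norm. It is the bound used on the exceptional event.\<close>

lemma ftilde_error_crude:
  assumes f: "L2 f" and B: "integral\<^sup>L circM (\<lambda>x. (f x)\<^sup>2) \<le> B"
  shows "l2sq (\<lambda>x. ftilde n m \<omega> x - f x) \<le> ennreal (2 * (real n)\<^sup>2 + 2 * B)"
proof -
  define g where "g = ftilde n m \<omega>"
  have "L2 g \<and> integral\<^sup>L circM (\<lambda>x. (g x)\<^sup>2) \<le> (real n)\<^sup>2"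
  proof (cases "l2sq (fring n m \<omega>) \<le> ennreal ((real n)\<^sup>2)")
    case True
    then have "g = fring n m \<omega>"
      by (simp add: g_def ftilde_def fun_eq_iff)
    then show ?thesis
      using True L2_trig[of m "ahat n m \<omega>"] by (simp add: fring_eq_trig l2sq_L2)
  next
    case False
    then have "g = (\<lambda>_. 0)"
      by (simp add: g_def ftilde_def fun_eq_iff)
    then show ?thesis
      by (simp add: L2_def)
  qed
  then have g: "L2 g" and gn: "integral\<^sup>L circM (\<lambda>x. (g x)\<^sup>2) \<le> (real n)\<^sup>2"
    by auto
  have "integral\<^sup>L circM (\<lambda>x. (g x - f x)\<^sup>2) \<le> integral\<^sup>L circM (\<lambda>x. 2 * (g x)\<^sup>2 + 2 * (f x)\<^sup>2)"
  proof (rule integral_mono)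
    show "integrable circM (\<lambda>x. (g x - f x)\<^sup>2)"
      using L2_diff[OF g f] by (simp add: L2_def)
    show "integrable circM (\<lambda>x. 2 * (g x)\<^sup>2 + 2 * (f x)\<^sup>2)"
      using g f by (simp add: L2_def)
    show "(g x - f x)\<^sup>2 \<le> 2 * (g x)\<^sup>2 + 2 * (f x)\<^sup>2" for x
      using zero_le_power2[of "g x + f x"] by (simp add: power2_eq_square algebra_simps)
  qed
  also have "\<dots> \<le> 2 * (real n)\<^sup>2 + 2 * B"
    using g f gn B by (simp add: L2_def)
  finally show ?thesis
    unfolding g_def[symmetric] l2sq_L2[OF L2_diff[OF g f]] by (rule ennreal_leI)
qed

text \<open>The truncation at \<open>n\<^sup>2\<close> only replaces estimators that are farther from \<open>f\<close> than \<open>0\<close>,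
  unless \<open>n\<^sup>2 < 4 B\<close>.\<close>

lemma ftilde_error_le_fring_error:
  assumes f: "L2 f" and B: "integral\<^sup>L circM (\<lambda>x. (f x)\<^sup>2) \<le> B" "1 \<le> B" and n: "0 < n"
  shows "l2sq (\<lambda>x. ftilde n m \<omega> x - f x)
    \<le> ennreal (integral\<^sup>L circM (\<lambda>x. (fring n m \<omega> x - f x)\<^sup>2) + 2 * B\<^sup>2 / real n)"
proof (cases "l2sq (fring n m \<omega>) \<le> ennreal ((real n)\<^sup>2)")
  case True
  have "l2sq (\<lambda>x. ftilde n m \<omega> x - f x) = ennreal (integral\<^sup>L circM (\<lambda>x. (fring n m \<omega> x - f x)\<^sup>2))"
    using True L2_diff[OF L2_trig f] by (simp add: ftilde_def fring_eq_trig l2sq_L2)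
  then show ?thesis
    by (simp add: ennreal_leI)
next
  case False
  define T where "T = integral\<^sup>L circM (\<lambda>x. (fring n m \<omega> x)\<^sup>2)"
  define r where "r = integral\<^sup>L circM (\<lambda>x. (fring n m \<omega> x - f x)\<^sup>2)"
  define F where "F = integral\<^sup>L circM (\<lambda>x. (f x)\<^sup>2)"
  have t: "L2 (fring n m \<omega>)"
    by (simp add: fring_eq_trig L2_trig)
  have "0 \<le> r" "0 \<le> F"
    by (simp_all add: r_def F_def)
  have "(real n)\<^sup>2 < T"
    using False by (simp add: l2sq_L2[OF t] T_def)
  have "T \<le> integral\<^sup>L circM (\<lambda>x. 2 * (fring n m \<omega> x - f x)\<^sup>2 + 2 * (f x)\<^sup>2)"
    unfolding T_def
  proof (rule integral_mono)
    show "integrable circM (\<lambda>x. (fring n m \<omega> x)\<^sup>2)"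
      using t by (simp add: L2_def)
    show "integrable circM (\<lambda>x. 2 * (fring n m \<omega> x - f x)\<^sup>2 + 2 * (f x)\<^sup>2)"
      using L2_diff[OF t f] f by (simp add: L2_def)
    show "(fring n m \<omega> x)\<^sup>2 \<le> 2 * (fring n m \<omega> x - f x)\<^sup>2 + 2 * (f x)\<^sup>2" for x
      using zero_le_power2[of "fring n m \<omega> x - f x - f x"] by (simp add: power2_eq_square algebra_simps)
  qed
  also have "\<dots> = 2 * r + 2 * F"
    using L2_diff[OF t f] f by (simp add: L2_def r_def F_def)
  finally have T: "T \<le> 2 * r + 2 * F" .
  \<comment> \<open>For large \<open>n\<close>, a squared norm \<open>T\<close> above n^2 \<ge> 4 B
    exceeds 4 F, and T \<le> 2 r + 2 F then gives F \<le> r. For small \<open>n\<close>,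
    \<open>1 \<le> B\<close> turns n^2 < 4 B into n \<le> 2 B, so the extra term alone is at least
    \<open>B\<close>.\<close>
  have "F \<le> r + 2 * B\<^sup>2 / real n"
  proof (cases "4 * B \<le> (real n)\<^sup>2")
    case True
    then have "F \<le> r"
      using T \<open>(real n)\<^sup>2 < T\<close> B by (simp add: F_def[symmetric])
    then show ?thesis
      using n by (simp add: add_increasing2)
  next
    case False
    have "4 * B \<le> 4 * B\<^sup>2"
      using B(2) by (simp add: power2_eq_square)
    then have "(real n)\<^sup>2 \<le> (2 * B)\<^sup>2"
      using False by (simp add: power_mult_distrib)
    then have "real n \<le> 2 * B"
      by (rule power2_le_imp_le) (use B in simp)
    then have "B * real n \<le> B * (2 * B)"
      using B(2) by (intro mult_left_mono) auto
    then have "B \<le> 2 * B\<^sup>2 / real n"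
      using n by (simp add: field_simps power2_eq_square)
    then show ?thesis
      using B(1) \<open>0 \<le> r\<close> by (simp add: F_def)
  qed
  moreover have "l2sq (\<lambda>x. ftilde n m \<omega> x - f x) = ennreal F"
    using False l2sq_L2[OF f] by (simp add: ftilde_def F_def l2sq_circM)
  ultimately show ?thesis
    unfolding r_def[symmetric] by (simp only: ennreal_leI)
qed

section \<open>The censored model\<close>

locale censored_model =
  fixes f :: "real \<Rightarrow> real" and \<mu> :: "(real \<times> real) measure" and s :: real
  assumes density: "is_density f" and bounded: "in_Linf f"
    and censor: "censor_law \<mu>" and coverage: "assmA \<mu> s"
begin

text \<open>The added 1 puts \<open>bnd\<close> strictly above the infimum defining
  \<open>linf\<close>, so that an admissible bound lies below it, and together with the absolute
  value it ensures \<open>1 \<le> bnd\<close>, as the truncation estimate requires.\<close>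

definition bnd :: real where
  "bnd = \<bar>linf f\<bar> + 1"

lemma s_pos: "0 < s"
  using coverage by (simp add: assmA_def)

lemma f_borel [measurable]: "f \<in> borel_measurable borel"
  using density by (simp add: is_density_def)

lemma f_AE_bound: "AE x in circM. \<bar>f x\<bar> \<le> bnd"
proof -
  let ?S = "{M. AE x in lborel. x \<in> circ \<longrightarrow> \<bar>f x\<bar> \<le> M}"
  have ne: "?S \<noteq> {}"
    using bounded by (auto simp: in_Linf_def)
  have "Inf ?S < bnd"
    by (simp add: bnd_def linf_def)
  from cInf_lessD[OF ne this] obtain M where M: "M \<in> ?S" "M < bnd" ..
  from M(1) have "AE x in circM. \<bar>f x\<bar> \<le> M"
    unfolding AE_circM_iff by simp
  then show ?thesis
    by eventually_elim (use M(2) in simp)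
qed

lemma f_L2: "L2 f"
  by (rule L2_bounded[OF _ f_AE_bound]) (simp add: borel_measurable_circM)

lemma f_nonneg: "AE x in circM. 0 \<le> f x"
  using density by (intro AE_I2) (simp add: is_density_def)

lemma f_integral: "integrable circM f" "integral\<^sup>L circM f = 1"
proof -
  have "(\<integral>\<^sup>+ x. ennreal (f x) \<partial>circM) = 1"
    using density unfolding circM_def by (subst nn_integral_restrict_space) (auto simp: is_density_def)
  moreover show "integrable circM f"
    using f_AE_bound by (intro circM.integrable_const_bound[of _ bnd]) (auto intro: borel_measurable_circM)
  ultimately show "integral\<^sup>L circM f = 1"
    using nn_integral_eq_integral[OF _ f_nonneg] by simp
qed

lemma f_norm: "integral\<^sup>L circM (\<lambda>x. (f x)\<^sup>2) \<le> bnd"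
proof -
  have "integral\<^sup>L circM (\<lambda>x. (f x)\<^sup>2) \<le> integral\<^sup>L circM (\<lambda>x. bnd * f x)"
  proof (rule integral_mono_AE)
    show "integrable circM (\<lambda>x. (f x)\<^sup>2)"
      using f_L2 by (simp add: L2_def)
    show "AE x in circM. (f x)\<^sup>2 \<le> bnd * f x"
      using f_AE_bound f_nonneg by eventually_elim (auto simp: power2_eq_square intro: mult_right_mono)
  qed (use f_integral in simp)
  then show ?thesis
    by (simp add: f_integral)
qed

lemma sets_Xlaw [measurable_cong]: "sets (Xlaw f) = sets borel"
  by (simp add: Xlaw_def)

lemma Xlaw_eq: "Xlaw f = density lborel (\<lambda>x. ennreal (f x * indicator circ x))"
  unfolding Xlaw_def by (intro arg_cong2[where f = density] refl) (auto simp: indicator_def)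

lemma integral_Xlaw:
  assumes [measurable]: "g \<in> borel_measurable borel"
  shows "integral\<^sup>L (Xlaw f) g = integral\<^sup>L circM (\<lambda>x. f x * g x)"
proof -
  have "integral\<^sup>L (Xlaw f) g = (LINT x|lborel. (f x * indicator circ x) *\<^sub>R g x)"
    unfolding Xlaw_eq using density
    by (intro integral_density) (auto simp: is_density_def indicator_def)
  also have "\<dots> = (LINT x:circ|lborel. f x * g x)"
    by (simp add: set_lebesgue_integral_def mult_ac)
  finally show ?thesis
    by (simp add: set_integral_circ)
qed

sublocale X: prob_space "Xlaw f"
proof
  have "emeasure (Xlaw f) (space (Xlaw f)) = (\<integral>\<^sup>+ x. ennreal (f x) * indicator circ x \<partial>lborel)"
    unfolding Xlaw_def by (subst emeasure_density) (auto intro!: nn_integral_cong)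
  then show "emeasure (Xlaw f) (space (Xlaw f)) = 1"
    using density by (simp add: is_density_def)
qed

sublocale C: prob_space \<mu>
  using censor by (simp add: censor_law_def)

lemma sets_censor [measurable_cong]: "sets \<mu> = sets (borel \<Otimes>\<^sub>M borel)"
  using censor unfolding censor_law_def borel_prod by blast

sublocale XC: pair_prob_space "Xlaw f" \<mu> ..

abbreviation "Q \<equiv> Xlaw f \<Otimes>\<^sub>M \<mu>"

lemma sampleM_eq: "sampleM f \<mu> n = PiM {..<n} (\<lambda>_. Q)"
  by (simp add: sampleM_def)

lemma prob_space_sampleM: "prob_space (sampleM f \<mu> n)"
  unfolding sampleM_eq by (intro prob_space_PiM XC.prob_space_axioms)

text \<open>The subtracted integral is the conditional expectation given the arc, not the overall
  mean. Averaged over the sample it becomes the integral of \<open>f * phi k\<close> against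
  \<open>sigma_hat\<close>.\<close>

definition score :: "nat \<Rightarrow> real \<times> real \<times> real \<Rightarrow> real" where
  "score k z = indicator (arc (fst (snd z)) (snd (snd z))) (fst z) * phi k (fst z)
     - integral\<^sup>L (Xlaw f) (\<lambda>y. indicator (arc (fst (snd z)) (snd (snd z))) y * phi k y)"

lemma score_measurable [measurable]: "score k \<in> borel_measurable Q"
  unfolding score_def[abs_def] by measurable

lemma score_bound: "\<bar>score k z\<bar> \<le> 2"
proof -
  have *: "\<bar>indicator (arc l u) x * phi k x\<bar> \<le> 1" for l u x
    using phi_abs_le_1[of k x] by (simp add: indicator_def)
  have "\<bar>integral\<^sup>L (Xlaw f) (\<lambda>y. indicator (arc l u) y * phi k y)\<bar> \<le> 1" for l u
  proof -
    have "\<bar>integral\<^sup>L (Xlaw f) (\<lambda>y. indicator (arc l u) y * phi k y)\<bar> \<le> integral\<^sup>L (Xlaw f) (\<lambda>y. 1)"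
      by (intro integral_abs_bound[THEN order_trans] integral_mono X.integrable_const_bound[of _ 1])
         (use * in auto)
    then show ?thesis
      using X.prob_space by simp
  qed
  from this[of "fst (snd z)" "snd (snd z)"] show ?thesis
    unfolding score_def using *[of "fst (snd z)" "snd (snd z)" "fst z"]
    by (intro order_trans[OF abs_triangle_ineq4]) linarith
qed

lemma score_mean: "integral\<^sup>L Q (score k) = 0"
proof -
  have inner: "(\<integral>x. score k (x, p) \<partial>Xlaw f) = 0" for p
  proof -
    have "integrable (Xlaw f) (\<lambda>y. indicator (arc (fst p) (snd p)) y * phi k y)"
      using phi_abs_le_1 by (intro X.integrable_const_bound[of _ 1]) (auto simp: indicator_def)
    then show ?thesis
      using X.prob_space by (simp add: score_def)
  qed
  have "integrable Q (score k)"
    by (rule XC.integrable_const_bound[of _ 2]) (auto simp: score_bound)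
  then have "integral\<^sup>L Q (\<lambda>(x, p). score k (x, p)) = (\<integral>p. (\<integral>x. score k (x, p) \<partial>Xlaw f) \<partial>\<mu>)"
    by (intro XC.integral_snd[symmetric]) (simp add: case_prod_beta')
  then show ?thesis
    by (simp add: case_prod_beta' inner)
qed

definition noise :: "nat \<Rightarrow> (nat \<Rightarrow> real \<times> real \<times> real) \<Rightarrow> nat \<Rightarrow> real" where
  "noise n \<omega> k = (1 / real n) * (\<Sum>i<n. score k (\<omega> i))"

lemma noise_eq:
  "noise n \<omega> k = Uhat n \<omega> k - integral\<^sup>L circM (\<lambda>x. f x * phi k x * sigma_hat n \<omega> x)"
proof -
  have "score k (\<omega> i) = Delta \<omega> i * phi k (Xobs \<omega> i)
      - integral\<^sup>L circM (\<lambda>x. f x * phi k x * indicator (arc (Ls \<omega> i) (Us \<omega> i)) x)" for i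
  proof -
    have "integral\<^sup>L (Xlaw f) (\<lambda>y. indicator (arc (Ls \<omega> i) (Us \<omega> i)) y * phi k y)
        = integral\<^sup>L circM (\<lambda>x. f x * phi k x * indicator (arc (Ls \<omega> i) (Us \<omega> i)) x)"
      by (subst integral_Xlaw) (auto simp: mult_ac)
    \<comment> \<open>The placeholder -pi in \<open>Xobs\<close> occurs only where the factor
      \<open>Delta\<close> is 0.\<close>
    moreover have "indicator (arc (Ls \<omega> i) (Us \<omega> i)) (Xs \<omega> i) * phi k (Xs \<omega> i) = Delta \<omega> i * phi k (Xobs \<omega> i)"
      by (auto simp: Delta_def Xobs_def indicator_def)
    ultimately show ?thesis
      by (simp add: score_def Ls_def Us_def Xs_def)
  qed
  then show ?thesis
    by (simp add: noise_def Uhat_def integral_mult_sigma_hat L2_mult_integrable f_L2 L2_phi sum_subtractf right_diff_distrib)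
qed

lemma noise_measurable [measurable]: "(\<lambda>\<omega>. noise n \<omega> k) \<in> borel_measurable (sampleM f \<mu> n)"
proof -
  have "(\<lambda>\<omega>. score k (\<omega> i)) \<in> borel_measurable (sampleM f \<mu> n)" if "i < n" for i
    unfolding sampleM_eq using that by (intro measurable_compose[OF measurable_component_singleton]) auto
  then show ?thesis
    unfolding noise_def by (auto intro!: borel_measurable_sum borel_measurable_times)
qed

text \<open>Each coordinate contributes n * 2^2 / n^2, the 2 being the uniform bound on
  \<open>score\<close>; there are \<open>Dm m\<close> coordinates.\<close>

lemma noise_second_moment:
  assumes "0 < n"
  shows "(\<integral>\<^sup>+ \<omega>. ennreal (\<Sum>k\<le>2*m. (noise n \<omega> k)\<^sup>2) \<partial>sampleM f \<mu> n) \<le> ennreal (4 * real (Dm m) / real n)"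
proof -
  have 1: "(\<integral>\<^sup>+ \<omega>. ennreal ((noise n \<omega> k)\<^sup>2) \<partial>sampleM f \<mu> n) \<le> ennreal (4 / real n)" for k
  proof -
    have m: "(\<lambda>\<omega>. (\<Sum>i<n. score k (\<omega> i))) \<in> borel_measurable (PiM {..<n} (\<lambda>_. Q))"
      by (intro borel_measurable_sum measurable_compose[OF measurable_component_singleton]) auto
    have "(\<integral>\<^sup>+ \<omega>. ennreal ((noise n \<omega> k)\<^sup>2) \<partial>sampleM f \<mu> n)
        = (\<integral>\<^sup>+ \<omega>. ennreal (1 / (real n)\<^sup>2) * ennreal ((\<Sum>i<n. score k (\<omega> i))\<^sup>2) \<partial>PiM {..<n} (\<lambda>_. Q))"
      unfolding sampleM_eq noise_def
      by (intro nn_integral_cong) (simp add: power_mult_distrib power_divide ennreal_mult'[symmetric])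
    also have "\<dots> = ennreal (1 / (real n)\<^sup>2) * (\<integral>\<^sup>+ \<omega>. ennreal ((\<Sum>i<n. score k (\<omega> i))\<^sup>2) \<partial>PiM {..<n} (\<lambda>_. Q))"
      using m by (intro nn_integral_cmult) measurable
    also have "\<dots> \<le> ennreal (1 / (real n)\<^sup>2) * ennreal (real n * 2\<^sup>2)"
      by (intro mult_left_mono iid_centered_second_moment XC.prob_space_axioms score_bound score_mean) auto
    also have "\<dots> = ennreal (4 / real n)"
      using assms by (simp add: ennreal_mult'[symmetric] power2_eq_square)
    finally show ?thesis .
  qed
  have "(\<integral>\<^sup>+ \<omega>. ennreal (\<Sum>k\<le>2*m. (noise n \<omega> k)\<^sup>2) \<partial>sampleM f \<mu> n)
      = (\<Sum>k\<le>2*m. \<integral>\<^sup>+ \<omega>. ennreal ((noise n \<omega> k)\<^sup>2) \<partial>sampleM f \<mu> n)"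
    by (simp add: sum_ennreal[symmetric] nn_integral_sum del: sum_ennreal)
  also have "\<dots> \<le> (\<Sum>k\<le>2*m. ennreal (4 / real n))"
    by (intro sum_mono 1)
  also have "\<dots> = ennreal (4 * real (Dm m) / real n)"
    by (subst sum_ennreal) (auto simp: Dm_def)
  finally show ?thesis .
qed

text \<open>The number of cells depends on \<open>s\<close> alone, so Hoeffding's inequality and a union bound
  control the essential infimum of the empirical coverage at an exponential rate.\<close>

lemma sigma_hat_lower_whp:
  assumes n: "0 < n"
  obtains bad where "bad \<in> sets (sampleM f \<mu> n)"
    "emeasure (sampleM f \<mu> n) bad \<le> ennreal (real (nat \<lfloor>16 / s\<rfloor> + 1) * exp (- (s\<^sup>2 / 8) * real n))"
    "AE \<omega> in sampleM f \<mu> n. (\<forall>i<n. Ls \<omega> i \<in> circ \<and> Us \<omega> i \<in> circ) \<and>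
        (\<omega> \<notin> bad \<longrightarrow> (AE x in circM. s / 2 \<le> sigma_hat n \<omega> x))"
proof -
  interpret P: prob_space "sampleM f \<mu> n"
    by (rule prob_space_sampleM)
  define J where "J = nat \<lfloor>16 / s\<rfloor>"
  obtain E I where E: "\<And>j. j \<le> J \<Longrightarrow> E j \<in> sets borel"
    "\<And>j. j \<le> J \<Longrightarrow> 3 / 4 * s \<le> measure \<mu> (E j)"
    "\<And>j p x. j \<le> J \<Longrightarrow> p \<in> E j \<Longrightarrow> fst p \<in> circ \<Longrightarrow> snd p \<in> circ \<Longrightarrow> x \<in> I j \<Longrightarrow> x \<in> arc (fst p) (snd p)"
    "finite (circ - (\<Union>j\<le>J. I j))"
    by (rule arc_cells[OF censor coverage, folded J_def]) (rule that)
  define rare where "rare j = {\<omega> \<in> space (sampleM f \<mu> n). (\<Sum>i<n. indicator (E j) (snd (\<omega> i))) \<le> real n * (s / 2)}" for j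
  have rare: "rare j \<in> sets (sampleM f \<mu> n)" "measure (sampleM f \<mu> n) (rare j) \<le> exp (- (s\<^sup>2 / 8) * real n)"
    if j: "j \<le> J" for j
  proof -
    have Ej: "E j \<in> sets \<mu>"
      using E(1)[OF j] censor by (auto simp: censor_law_def)
    define E' where "E' = space (Xlaw f) \<times> E j"
    have E': "E' \<in> sets Q"
      unfolding E'_def using Ej by auto
    have mE': "measure Q E' = measure \<mu> (E j)"
      unfolding E'_def using Ej by (simp add: measure_def C.emeasure_pair_measure_Times X.emeasure_space_1)
    have ind: "indicator E' z = (indicator (E j) (snd z) :: real)" for z
      by (cases z) (auto simp: E'_def indicator_def Xlaw_def)
    have eq: "rare j = {\<omega> \<in> space (PiM {..<n} (\<lambda>_. Q)). (\<Sum>i<n. indicator E' (\<omega> i)) \<le> real n * (s / 2)}"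
      by (simp add: rare_def sampleM_eq ind)
    \<comment> \<open>The exact margin makes the Hoeffding event coincide with
      \<open>rare j\<close>; replacing it by its lower bound \<open>s / 4\<close> afterwards only
      enlarges the exponential.\<close>
    define t where "t = measure Q E' - s / 2"
    have t: "s / 4 \<le> t"
      using E(2)[OF j] by (simp add: t_def mE')
    have "(\<lambda>\<omega>. (\<Sum>i<n. indicator E' (\<omega> i) :: real)) \<in> borel_measurable (PiM {..<n} (\<lambda>_. Q))"
      using E' by (intro borel_measurable_sum measurable_compose[OF measurable_component_singleton]) auto
    then show "rare j \<in> sets (sampleM f \<mu> n)"
      unfolding eq unfolding sampleM_eq by measurable
    have "measure (sampleM f \<mu> n) (rare j) \<le> exp (- 2 * real n * t\<^sup>2)"
      using iid_frequency_lower_tail[OF XC.prob_space_axioms E' n, of t] t s_pos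
      by (simp add: eq sampleM_eq t_def)
    also have "\<dots> \<le> exp (- 2 * real n * (s / 4)\<^sup>2)"
      using t s_pos by (auto intro!: mult_left_mono power_mono)
    also have "\<dots> = exp (- (s\<^sup>2 / 8) * real n)"
      by (simp add: power2_eq_square)
    finally show "measure (sampleM f \<mu> n) (rare j) \<le> exp (- (s\<^sup>2 / 8) * real n)" .
  qed
  define bad where "bad = (\<Union>j\<le>J. rare j)"
  have "measure (sampleM f \<mu> n) bad \<le> (\<Sum>j\<le>J. measure (sampleM f \<mu> n) (rare j))"
    unfolding bad_def using rare by (intro P.finite_measure_subadditive_finite) auto
  also have "\<dots> \<le> (\<Sum>j\<le>J. exp (- (s\<^sup>2 / 8) * real n))"
    by (intro sum_mono rare) auto
  finally have "emeasure (sampleM f \<mu> n) bad \<le> ennreal (real (J + 1) * exp (- (s\<^sup>2 / 8) * real n))"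
    by (simp add: P.emeasure_eq_measure ennreal_leI)
  moreover have "bad \<in> sets (sampleM f \<mu> n)"
    unfolding bad_def using rare by auto
  moreover have "AE \<omega> in sampleM f \<mu> n. (\<forall>i<n. Ls \<omega> i \<in> circ \<and> Us \<omega> i \<in> circ) \<and>
        (\<omega> \<notin> bad \<longrightarrow> (AE x in circM. s / 2 \<le> sigma_hat n \<omega> x))"
  proof -
    have "AE z in Q. fst (snd z) \<in> circ \<and> snd (snd z) \<in> circ"
    proof (rule XC.AE_pair_measure)
      show "{z \<in> space Q. fst (snd z) \<in> circ \<and> snd (snd z) \<in> circ} \<in> sets Q"
        by measurable
      have "AE p in \<mu>. fst p \<in> circ \<and> snd p \<in> circ"
        using censor by (auto simp: censor_law_def)
      then show "AE x in Xlaw f. AE y in \<mu>. fst (snd (x, y)) \<in> circ \<and> snd (snd (x, y)) \<in> circ"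
        by simp
    qed
    then have "AE \<omega> in sampleM f \<mu> n. \<forall>i\<in>{..<n}. fst (snd (\<omega> i)) \<in> circ \<and> snd (snd (\<omega> i)) \<in> circ"
      unfolding sampleM_eq
      by (intro AE_finite_allI AE_PiM_component[where P = "\<lambda>z. fst (snd z) \<in> circ \<and> snd (snd z) \<in> circ"]
            XC.prob_space_axioms) auto
    then show ?thesis
      using AE_space
    proof eventually_elim
      case (elim \<omega>)
      then have circ: "\<forall>i<n. Ls \<omega> i \<in> circ \<and> Us \<omega> i \<in> circ"
        by (auto simp: Ls_def Us_def)
      have "AE x in circM. s / 2 \<le> sigma_hat n \<omega> x" if "\<omega> \<notin> bad"
      proof -
        have "AE x in lborel. x \<notin> circ - (\<Union>j\<le>J. I j)"
          using E(4) by (intro AE_not_in) (simp add: finite_imp_null_set_lborel)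
        then have "AE x in circM. x \<in> (\<Union>j\<le>J. I j)"
          unfolding AE_circM_iff by eventually_elim auto
        then show ?thesis
        proof eventually_elim
          case (elim x)
          then obtain j where j: "j \<le> J" "x \<in> I j" by auto
          have "real n * (s / 2) \<le> (\<Sum>i<n. indicator (E j) (snd (\<omega> i)))"
          proof -
            have "\<omega> \<notin> rare j"
              using that j by (auto simp: bad_def)
            then show ?thesis
              using \<open>\<omega> \<in> space (sampleM f \<mu> n)\<close> by (simp add: rare_def)
          qed
          also have "\<dots> \<le> (\<Sum>i<n. indicator (arc (Ls \<omega> i) (Us \<omega> i)) x)"
            using E(3)[OF j(1) _ _ _ j(2)] circ
            by (intro sum_mono) (auto simp: indicator_def Ls_def Us_def)
          finally show ?case
            using n by (simp only: sigma_hat_def) (simp add: field_simps)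
        qed
      qed
      with circ show ?case by blast
    qed
  qed
  ultimately show thesis
    using that unfolding J_def by blast
qed

end

section \<open>Risk bounds\<close>

text \<open>Both follow from y \<le> exp y, at x and, after cubing, at x/3; hence 27.\<close>

lemma exp_minus_le_inverse_powers:
  fixes x :: real
  assumes "0 < x"
  shows "exp (- x) \<le> 1 / x" "exp (- x) \<le> 27 / x ^ 3"
proof -
  have *: "y \<le> exp y" for y :: real
    using exp_ge_add_one_self[of y] by linarith
  have inv: "exp (- x) = 1 / exp x"
    by (simp add: exp_minus field_simps)
  show "exp (- x) \<le> 1 / x"
    unfolding inv using *[of x] assms by (intro divide_left_mono) auto
  have "(x / 3) ^ 3 \<le> exp (x / 3) ^ 3"
    using *[of "x / 3"] assms by (intro power_mono) auto
  also have "\<dots> = exp x"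
    by (simp add: exp_of_nat_mult[symmetric])
  finally have "1 / exp x \<le> 1 / (x / 3) ^ 3"
    using assms by (intro divide_left_mono) auto
  then show "exp (- x) \<le> 27 / x ^ 3"
    unfolding inv by (simp add: power_divide)
qed

text \<open>The second summand bounds \<open>n\<close> times the loss on the exceptional event, using
  \<open>n\<^sup>2 exp (- c n) \<le> 27 / (c\<^sup>3 n)\<close> and \<open>exp (- c n) \<le> 1 / (c n)\<close> with \<open>c = s\<^sup>2 / 8\<close>.\<close>

definition remainder :: "real \<Rightarrow> real \<Rightarrow> real" where
  "remainder s x = 2 * (\<bar>x\<bar> + 1)\<^sup>2
     + real (nat \<lfloor>16 / s\<rfloor> + 1) * (54 / (s\<^sup>2 / 8) ^ 3 + 2 * (\<bar>x\<bar> + 1) / (s\<^sup>2 / 8))"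

lemma remainder_nonneg: "0 < s \<Longrightarrow> 0 \<le> remainder s x"
  unfolding remainder_def by (intro add_nonneg_nonneg mult_nonneg_nonneg) auto

lemma bad_event_contribution:
  assumes "0 < s" "0 < n"
  shows "2 * (\<bar>x\<bar> + 1)\<^sup>2 / real n
      + (2 * (real n)\<^sup>2 + 2 * (\<bar>x\<bar> + 1)) * (real (nat \<lfloor>16 / s\<rfloor> + 1) * exp (- (s\<^sup>2 / 8) * real n))
    \<le> remainder s x / real n"
proof -
  define c where "c = s\<^sup>2 / 8"
  define K where "K = real (nat \<lfloor>16 / s\<rfloor> + 1)"
  define b where "b = \<bar>x\<bar> + 1"
  have c: "0 < c" "0 \<le> K" "0 < b" "0 < c * real n"
    using assms by (auto simp: c_def K_def b_def)
  have "(real n)\<^sup>2 * exp (- (c * real n)) \<le> (real n)\<^sup>2 * (27 / (c * real n) ^ 3)"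
    using exp_minus_le_inverse_powers(2)[OF c(4)] by (intro mult_left_mono) auto
  also have "\<dots> = 27 / c ^ 3 / real n"
    using assms c by (simp add: power2_eq_square power3_eq_cube)
  finally have 1: "(real n)\<^sup>2 * exp (- (c * real n)) \<le> 27 / c ^ 3 / real n" .
  have "b * exp (- (c * real n)) \<le> b * (1 / (c * real n))"
    using exp_minus_le_inverse_powers(1)[OF c(4)] c by (intro mult_left_mono) auto
  then have "(real n)\<^sup>2 * exp (- (c * real n)) + b * exp (- (c * real n)) \<le> 27 / c ^ 3 / real n + b / c / real n"
    using 1 by simp
  then have "2 * K * ((real n)\<^sup>2 * exp (- (c * real n)) + b * exp (- (c * real n))) \<le> 2 * K * (27 / c ^ 3 / real n + b / c / real n)"
    using c by (intro mult_left_mono) auto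
  then have "2 * b\<^sup>2 / real n + (2 * (real n)\<^sup>2 + 2 * b) * (K * exp (- c * real n))
      \<le> 2 * b\<^sup>2 / real n + 2 * K * (27 / c ^ 3 / real n + b / c / real n)"
    by (simp add: algebra_simps)
  also have "\<dots> = (2 * b\<^sup>2 + K * (54 / c ^ 3 + 2 * b / c)) / real n"
    by (simp add: add_divide_distrib distrib_left mult_ac)
  finally show ?thesis
    unfolding remainder_def c_def[symmetric] K_def[symmetric] b_def[symmetric] .
qed

context censored_model begin

text \<open>The loss is dominated almost everywhere by a constant, a multiple of the noise energy
  and a multiple of the indicator of \<open>bad\<close>. Linearity is used only for this measurable
  majorant, so measurability of the definite description in \<open>ahat\<close> never arises. The
  variance constant 32 is 8, from the deterministic bound, times 4, from the second moment of the
  noise.\<close>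

theorem oracle_inequality:
  assumes n: "0 < n"
  shows "risk f \<mu> n m \<le> ennreal (1 + 8 / s\<^sup>2) * l2sq (\<lambda>x. proj m f x - f x)
    + ennreal (32 / s\<^sup>2 * real (Dm m) / real n + remainder s (linf f) / real n)"
proof -
  define R where "R = integral\<^sup>L circM (\<lambda>x. (proj m f x - f x)\<^sup>2)"
  have "0 \<le> R"
    by (simp add: R_def)
  have Reqn: "l2sq (\<lambda>x. proj m f x - f x) = ennreal R"
    unfolding R_def proj_eq_trig by (intro l2sq_L2 L2_diff L2_trig f_L2)
  have "1 \<le> bnd"
    by (simp add: bnd_def)
  obtain bad where bad [measurable]: "bad \<in> sets (sampleM f \<mu> n)"
    and P_bad: "emeasure (sampleM f \<mu> n) bad \<le> ennreal (real (nat \<lfloor>16 / s\<rfloor> + 1) * exp (- (s\<^sup>2 / 8) * real n))"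
    and good: "AE \<omega> in sampleM f \<mu> n. (\<forall>i<n. Ls \<omega> i \<in> circ \<and> Us \<omega> i \<in> circ) \<and>
        (\<omega> \<notin> bad \<longrightarrow> (AE x in circM. s / 2 \<le> sigma_hat n \<omega> x))"
    using sigma_hat_lower_whp[OF n] by blast
  interpret P: prob_space "sampleM f \<mu> n"
    by (rule prob_space_sampleM)
  let ?N = "\<lambda>\<omega>. \<Sum>k\<le>2*m. (noise n \<omega> k)\<^sup>2"
  let ?c = "ennreal ((1 + 8 / s\<^sup>2) * R + 2 * bnd\<^sup>2 / real n)"
  let ?b = "ennreal (2 * (real n)\<^sup>2 + 2 * bnd)"
  have "AE \<omega> in sampleM f \<mu> n. l2sq (\<lambda>x. ftilde n m \<omega> x - f x)
      \<le> ?c + ennreal (8 / s\<^sup>2) * ennreal (?N \<omega>) + ?b * indicator bad \<omega>"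
    using good
  proof eventually_elim
    case (elim \<omega>)
    show ?case
    proof (cases "\<omega> \<in> bad")
      case True
      have "l2sq (\<lambda>x. ftilde n m \<omega> x - f x) \<le> ?b"
        by (rule ftilde_error_crude[OF f_L2 f_norm])
      also have "\<dots> = ?b * indicator bad \<omega>"
        using True by simp
      finally show ?thesis
        by (rule order_trans) simp
    next
      case False
      have "l2sq (\<lambda>x. ftilde n m \<omega> x - f x)
          \<le> ennreal (integral\<^sup>L circM (\<lambda>x. (fring n m \<omega> x - f x)\<^sup>2) + 2 * bnd\<^sup>2 / real n)"
        by (rule ftilde_error_le_fring_error[OF f_L2 f_norm \<open>1 \<le> bnd\<close> n])
      also have "\<dots> \<le> ennreal ((1 + 8 / s\<^sup>2) * R + 2 * bnd\<^sup>2 / real n + 8 / s\<^sup>2 * ?N \<omega>)"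
      proof (rule ennreal_leI)
        have "integral\<^sup>L circM (\<lambda>x. (fring n m \<omega> x - f x)\<^sup>2) = R + (\<Sum>k\<le>2*m. (ahat n m \<omega> k - coeff f k)\<^sup>2)"
          unfolding fring_eq_trig R_def by (rule pythagoras_trig[OF f_L2])
        also have "\<dots> \<le> R + 8 / s\<^sup>2 * (?N \<omega> + R)"
          using elim False s_pos unfolding R_def
          by (intro add_left_mono estimation_error_deterministic f_L2 noise_eq) auto
        finally show "integral\<^sup>L circM (\<lambda>x. (fring n m \<omega> x - f x)\<^sup>2) + 2 * bnd\<^sup>2 / real n
            \<le> (1 + 8 / s\<^sup>2) * R + 2 * bnd\<^sup>2 / real n + 8 / s\<^sup>2 * ?N \<omega>"
          by (simp add: distrib_left distrib_right)
      qed
      also have "\<dots> = ?c + ennreal (8 / s\<^sup>2) * ennreal (?N \<omega>)"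
        using \<open>0 \<le> R\<close> by (simp only: ennreal_mult'[symmetric] ennreal_plus[symmetric] sum_nonneg
            zero_le_power2 add_nonneg_nonneg mult_nonneg_nonneg divide_nonneg_nonneg of_nat_0_le_iff
            zero_le_numeral zero_le_one)
      finally show ?thesis
        by (rule order_trans) simp
    qed
  qed
  then have "risk f \<mu> n m \<le> (\<integral>\<^sup>+ \<omega>. ?c + ennreal (8 / s\<^sup>2) * ennreal (?N \<omega>) + ?b * indicator bad \<omega> \<partial>sampleM f \<mu> n)"
    unfolding risk_def by (rule nn_integral_mono_AE)
  also have "\<dots> = ?c + ennreal (8 / s\<^sup>2) * (\<integral>\<^sup>+ \<omega>. ennreal (?N \<omega>) \<partial>sampleM f \<mu> n) + ?b * emeasure (sampleM f \<mu> n) bad"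
    by (simp add: nn_integral_add nn_integral_cmult P.emeasure_space_1 nn_integral_cmult_indicator)
  also have "\<dots> \<le> ?c + ennreal (8 / s\<^sup>2) * ennreal (4 * real (Dm m) / real n)
      + ?b * ennreal (real (nat \<lfloor>16 / s\<rfloor> + 1) * exp (- (s\<^sup>2 / 8) * real n))"
    by (intro add_mono mult_left_mono noise_second_moment n P_bad order_refl) auto
  also have "\<dots> = ennreal ((1 + 8 / s\<^sup>2) * R + 2 * bnd\<^sup>2 / real n + 8 / s\<^sup>2 * (4 * real (Dm m) / real n)
      + (2 * (real n)\<^sup>2 + 2 * bnd) * (real (nat \<lfloor>16 / s\<rfloor> + 1) * exp (- (s\<^sup>2 / 8) * real n)))"
    using \<open>0 \<le> R\<close> \<open>1 \<le> bnd\<close>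
    by (subst ennreal_mult'[symmetric], simp, subst ennreal_mult'[symmetric], simp,
        subst ennreal_plus[symmetric], simp, simp, subst ennreal_plus[symmetric]) auto
  also have "\<dots> \<le> ennreal ((1 + 8 / s\<^sup>2) * R + (32 / s\<^sup>2 * real (Dm m) / real n + remainder s (linf f) / real n))"
    using bad_event_contribution[OF s_pos n, of "linf f", folded bnd_def] by (intro ennreal_leI) simp
  also have "\<dots> = ennreal (1 + 8 / s\<^sup>2) * ennreal R + ennreal (32 / s\<^sup>2 * real (Dm m) / real n + remainder s (linf f) / real n)"
    using \<open>0 \<le> R\<close> remainder_nonneg[OF s_pos]
    by (subst ennreal_mult[symmetric], simp, simp, subst ennreal_plus[symmetric]) auto
  finally show ?thesis
    by (simp only: Reqn)
qed

section \<open>Bias and convergence rate over Sobolev classes\<close>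

lemma sobolev_bias:
  assumes W: "f \<in> Sobolev \<beta> R" and "0 < \<beta>"
  shows "integral\<^sup>L circM (\<lambda>x. (proj m f x - f x)\<^sup>2) \<le> R\<^sup>2 / pi powr (2 * \<beta>) * real (2 * m + 2) powr (- 2 * \<beta>)"
proof (rule proj_tail_bound[OF f_borel f_AE_bound])
  fix M assume "m \<le> M"
  define A where "A = real (2 * m + 2) powr (2 * \<beta>)"
  have "0 < A"
    by (simp add: A_def)
  \<comment> \<open>The first index beyond 2m is the odd 2m + 1, whose weight has base 2m + 2; the
    first even one is 2m + 2 itself. Both frequencies of the first omitted pair thus share the
    weight \<open>A\<close>.\<close>
  have al: "A \<le> (alpha \<beta> k)\<^sup>2" if "2 * m < k" for k
  proof -
    have "real (2 * m + 2) powr \<beta> \<le> alpha \<beta> k"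
    proof (cases "even k")
      case True
      then have "2 * m + 2 \<le> k"
        using that by (elim evenE) simp
      then show ?thesis
        using True \<open>0 < \<beta>\<close> unfolding alpha_def by (simp only: if_True) (intro powr_mono2, auto)
    next
      case False
      then show ?thesis
        using that \<open>0 < \<beta>\<close> unfolding alpha_def by (simp only: if_False) (intro powr_mono2, auto)
    qed
    then have "(real (2 * m + 2) powr \<beta>)\<^sup>2 \<le> (alpha \<beta> k)\<^sup>2"
      by (intro power_mono) auto
    moreover have "(real (2 * m + 2) powr \<beta>)\<^sup>2 = A"
      by (simp only: A_def power2_eq_square powr_add[symmetric]) simp
    ultimately show ?thesis by simp
  qed
  have "A * (\<Sum>k\<in>{2*m<..2*M}. (coeff f k)\<^sup>2) \<le> (\<Sum>k\<in>{2*m<..2*M}. (alpha \<beta> k)\<^sup>2 * (coeff f k)\<^sup>2)"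
    unfolding sum_distrib_left using al by (intro sum_mono mult_right_mono) auto
  also have "\<dots> \<le> (\<Sum>k. (alpha \<beta> k)\<^sup>2 * (coeff f k)\<^sup>2)"
    using W by (intro sum_le_suminf) (auto simp: Sobolev_def)
  also have "\<dots> \<le> R\<^sup>2 / pi powr (2 * \<beta>)"
    using W by (simp add: Sobolev_def)
  finally have "(\<Sum>k\<in>{2*m<..2*M}. (coeff f k)\<^sup>2) \<le> R\<^sup>2 / pi powr (2 * \<beta>) / A"
    using \<open>0 < A\<close> by (simp only: pos_le_divide_eq mult.commute)
  also have "\<dots> = R\<^sup>2 / pi powr (2 * \<beta>) * real (2 * m + 2) powr (- 2 * \<beta>)"
    unfolding A_def by (simp add: powr_minus divide_inverse)
  finally show "(\<Sum>k\<in>{2*m<..2*M}. (coeff f k)\<^sup>2) \<le> \<dots>" .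
qed

theorem sobolev_rate:
  assumes W: "f \<in> Sobolev \<beta> R" and "0 < \<beta>"
    and mn: "\<And>n. \<bar>real (Dm (mn n)) - real_of_int \<lfloor>real n powr (1 / (2*\<beta> + 1))\<rfloor>\<bar> \<le> 1"
  shows "\<exists>C. \<forall>\<^sub>F n in sequentially. risk f \<mu> n (mn n) \<le> ennreal (C * real n powr (- 2*\<beta> / (2*\<beta> + 1)))"
proof -
  define g where "g = 1 / (2 * \<beta> + 1)"
  have "0 < g"
    using \<open>0 < \<beta>\<close> by (simp add: g_def)
  \<comment> \<open>The second identity is the balance of the two errors: with dimension of order
    n^g, the variance n^(g - 1) equals the order (n^g)^(-2 \<beta>) of the squared bias.\<close>
  have rate: "- 2 * \<beta> / (2 * \<beta> + 1) = g * (- 2 * \<beta>)" "g - 1 = g * (- 2 * \<beta>)"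
    using \<open>0 < \<beta>\<close> by (simp_all add: g_def field_simps)
  define T where "T = R\<^sup>2 / pi powr (2 * \<beta>)"
  have "0 \<le> T"
    by (simp add: T_def)
  \<comment> \<open>The factor with base 1/2 pays for replacing 2m + 2 by its lower bound
    \<open>N / 2\<close> in the bias, and 64 = 32 * 2 pays for bounding the dimension by 2
    N.\<close>
  define C where "C = (1 + 8 / s\<^sup>2) * (T * (1 / 2) powr (- 2 * \<beta>)) + 64 / s\<^sup>2 + remainder s (linf f)"
  \<comment> \<open>The floor and the parity allowance cost at most 2: the dimension is at least N -
    2, so 2m + 2 \<ge> N - 1, and this exceeds N/2 once N \<ge> 2.\<close>
  have "\<forall>\<^sub>F n in sequentially. 2 \<le> real n powr g"
    using eventually_ge_at_top[of "nat \<lceil>2 powr (1 / g)\<rceil>"]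
  proof eventually_elim
    case (elim n)
    then have "(2 powr (1 / g)) powr g \<le> real n powr g"
      using \<open>0 < g\<close> by (intro powr_mono2) (auto simp: nat_ceiling_le_eq)
    then show ?case
      using \<open>0 < g\<close> by (simp add: powr_powr)
  qed
  moreover have "\<forall>\<^sub>F n in sequentially. 0 < n"
    by (rule eventually_gt_at_top)
  ultimately have "\<forall>\<^sub>F n in sequentially. risk f \<mu> n (mn n) \<le> ennreal (C * real n powr (- 2*\<beta> / (2*\<beta> + 1)))"
  proof eventually_elim
    case (elim n)
    define N where "N = real n powr g"
    define r where "r = real n powr (g * (- 2 * \<beta>))"
    have "2 \<le> N" "0 < n" "0 \<le> r"
      using elim by (auto simp: N_def r_def)
    have D: "N - 2 \<le> real (Dm (mn n))" "real (Dm (mn n)) \<le> N + 1"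
      using mn[of n] unfolding g_def[symmetric] N_def[symmetric] by linarith+
    have Nr: "N / real n = r"
    proof -
      have "N / real n = real n powr g / real n powr 1"
        using \<open>0 < n\<close> by (simp add: N_def)
      also have "\<dots> = r"
        by (simp only: r_def powr_diff[symmetric] rate(2))
      finally show ?thesis .
    qed
    have "N / 2 \<le> real (2 * mn n + 2)"
      using D \<open>2 \<le> N\<close> by (simp add: Dm_def)
    then have "real (2 * mn n + 2) powr (- 2 * \<beta>) \<le> (N * (1 / 2)) powr (- 2 * \<beta>)"
      using \<open>0 < \<beta>\<close> \<open>2 \<le> N\<close> by (intro powr_mono2') auto
    also have "\<dots> = r * (1 / 2) powr (- 2 * \<beta>)"
      using \<open>2 \<le> N\<close> by (subst powr_mult) (auto simp: N_def r_def powr_powr)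
    finally have "T * real (2 * mn n + 2) powr (- 2 * \<beta>) \<le> T * (r * (1 / 2) powr (- 2 * \<beta>))"
      using \<open>0 \<le> T\<close> by (rule mult_left_mono)
    then have bias: "integral\<^sup>L circM (\<lambda>x. (proj (mn n) f x - f x)\<^sup>2) \<le> T * (1 / 2) powr (- 2 * \<beta>) * r"
      using sobolev_bias[OF W \<open>0 < \<beta>\<close>, of "mn n", folded T_def] by (simp add: mult_ac)
    have "real (Dm (mn n)) / real n \<le> 2 * N / real n"
      using D \<open>2 \<le> N\<close> by (intro divide_right_mono) auto
    then have var: "real (Dm (mn n)) / real n \<le> 2 * r"
      using Nr by simp
    have "1 / real n \<le> N / real n"
      using \<open>2 \<le> N\<close> by (intro divide_right_mono) auto
    then have rem: "remainder s (linf f) * (1 / real n) \<le> remainder s (linf f) * r"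
      using remainder_nonneg[OF s_pos] Nr by (intro mult_left_mono) auto
    have "risk f \<mu> n (mn n) \<le> ennreal (1 + 8 / s\<^sup>2) * l2sq (\<lambda>x. proj (mn n) f x - f x)
        + ennreal (32 / s\<^sup>2 * real (Dm (mn n)) / real n + remainder s (linf f) / real n)"
      by (rule oracle_inequality[OF \<open>0 < n\<close>])
    also have "l2sq (\<lambda>x. proj (mn n) f x - f x) = ennreal (integral\<^sup>L circM (\<lambda>x. (proj (mn n) f x - f x)\<^sup>2))"
      unfolding proj_eq_trig by (intro l2sq_L2 L2_diff L2_trig f_L2)
    also have "ennreal (1 + 8 / s\<^sup>2) * \<dots> + ennreal (32 / s\<^sup>2 * real (Dm (mn n)) / real n + remainder s (linf f) / real n)
        \<le> ennreal (1 + 8 / s\<^sup>2) * ennreal (T * (1 / 2) powr (- 2 * \<beta>) * r)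
        + ennreal (32 / s\<^sup>2 * (2 * r) + remainder s (linf f) * r)"
      using bias mult_left_mono[OF var, of "32 / s\<^sup>2"] rem by (intro add_mono mult_left_mono ennreal_leI) auto
    also have "\<dots> = ennreal (C * r)"
      using \<open>0 \<le> T\<close> \<open>0 \<le> r\<close> remainder_nonneg[OF s_pos]
      by (subst ennreal_mult[symmetric], simp, simp, subst ennreal_plus[symmetric])
         (auto simp: C_def algebra_simps)
    finally show ?case
      unfolding rate(1) r_def[symmetric] .
  qed
  then show ?thesis by blast
qed

end

theorem theorem2:
  shows "(\<forall>\<sigma>0>0. \<exists>C1 C2::real. \<exists>C3::real \<Rightarrow> real.
            \<forall>f \<mu> n m. is_density f \<and> in_Linf f \<and> censor_law \<mu> \<and> assmA \<mu> \<sigma>0 \<and> m \<in> Mn n \<longrightarrow>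
              risk f \<mu> n m \<le> ennreal C1 * l2sq (\<lambda>x. proj m f x - f x)
                 + ennreal (C2 * real (Dm m) / real n + C3 (linf f) / real n))
       \<and> (\<forall>f \<mu> \<sigma>0 \<beta> R (mn::nat \<Rightarrow> nat).
            is_density f \<and> in_Linf f \<and> censor_law \<mu> \<and> assmA \<mu> \<sigma>0 \<and> \<beta> > 0 \<and> R > 0
            \<and> f \<in> Sobolev \<beta> R
            \<and> (\<forall>n. \<bar>real (Dm (mn n)) - real_of_int \<lfloor>real n powr (1 / (2*\<beta> + 1))\<rfloor>\<bar> \<le> 1) \<longrightarrow>
            (\<exists>C::real. \<forall>\<^sub>F n in sequentially.
               risk f \<mu> n (mn n) \<le> ennreal (C * real n powr (- 2*\<beta> / (2*\<beta> + 1)))))"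
proof (intro conjI allI impI)
  fix s :: real assume "0 < s"
  show "\<exists>C1 C2::real. \<exists>C3::real \<Rightarrow> real.
      \<forall>f \<mu> n m. is_density f \<and> in_Linf f \<and> censor_law \<mu> \<and> assmA \<mu> s \<and> m \<in> Mn n \<longrightarrow>
        risk f \<mu> n m \<le> ennreal C1 * l2sq (\<lambda>x. proj m f x - f x)
          + ennreal (C2 * real (Dm m) / real n + C3 (linf f) / real n)"
  proof (intro exI allI impI)
    fix f \<mu> n m
    assume A: "is_density f \<and> in_Linf f \<and> censor_law \<mu> \<and> assmA \<mu> s \<and> m \<in> Mn n"
    interpret censored_model f \<mu> s
      by unfold_locales (use A in auto)
    \<comment> \<open>For \<open>n = 0\<close> the index set \<open>Mn n\<close> is empty, by
      truncated subtraction.\<close>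
    have "0 < n"
      using A by (auto simp: Mn_def intro: gr0I)
    then show "risk f \<mu> n m \<le> ennreal (1 + 8 / s\<^sup>2) * l2sq (\<lambda>x. proj m f x - f x)
        + ennreal (32 / s\<^sup>2 * real (Dm m) / real n + remainder s (linf f) / real n)"
      by (rule oracle_inequality)
  qed
next
  fix f \<mu> s \<beta> R and mn :: "nat \<Rightarrow> nat"
  assume A: "is_density f \<and> in_Linf f \<and> censor_law \<mu> \<and> assmA \<mu> s \<and> \<beta> > 0 \<and> R > 0
      \<and> f \<in> Sobolev \<beta> R
      \<and> (\<forall>n. \<bar>real (Dm (mn n)) - real_of_int \<lfloor>real n powr (1 / (2*\<beta> + 1))\<rfloor>\<bar> \<le> 1)"
  interpret censored_model f \<mu> s
    by unfold_locales (use A in auto)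
  show "\<exists>C::real. \<forall>\<^sub>F n in sequentially.
      risk f \<mu> n (mn n) \<le> ennreal (C * real n powr (- 2*\<beta> / (2*\<beta> + 1)))"
    using A by (intro sobolev_rate[of \<beta> R]) auto
qed

end
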